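(* Every GIKN measure $\mu$ on $M$ has atomic disintegration with respect to the vertical fibers $\{\xi\}\times\mathbb{S}^1$ of $M$.
   Context: Setting: fix $k\in\mathbb{N}$ and $C^1$ diffeomorphisms $f_1,\dots,f_k:\mathbb{S}^1\to\mathbb{S}^1$. Let $\Sigma_k=\{1,\dots,k\}^{\mathbb{Z}}$ with the product topology, $\sigma:\Sigma_k\to\Sigma_k$ the shift map, $M=\Sigma_k\times\mathbb{S}^1$, and let $T:M\to M$ be the locally constant skew product $T(\xi,x)=(\sigma(\xi),f_{\omega_0}(x))$ for $\xi=(\omega_j)_{j\in\mathbb{Z}}$. A point $\xi\in\Sigma_k$ is generated by a finite word $\omega_1\dots\omega_{\pi}$ if it is the bi-infinite periodic repetition of that word, positioned so that coordinate $j$ of $\xi$ is $\omega_{j+1}$ for $0\le j\le \pi-1$. $O(x)$ denotes the $T$-orbit of $x$. For an interval $J\subset\mathbb{S}^1$, $|J|$ is its length. Definition (repetitive pattern). A sequence $X_n=O((\xi_n,q_n))$, $n\ge 0$, of $T$-periodic orbits, where $\xi_n\in\Sigma_k$ is generated by the finite word $\omega^n_1\dots\omega^n_{\pi_n}$, has a repetitive pattern if: (1) There is a nested sequence of intervals $J_{n+1}\subset J_n\subset\mathbb{S}^1$ with $q_n\in J_n$, $0<|J_{n+1}|<|J_n|$ for every $n$, and $|J_n|\to 0$. (2) The intervals $J_0$ and $f_{\omega^0_\ell}\circ\dots\circ f_{\omega^0_1}(J_0)$, $\ell=1,\dots,\pi_0-1$, are pairwise disjoint. (3) For each $n\ge 0$,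 the map $g_n=f_{\omega^n_{\pi_n}}\circ\dots\circ f_{\omega^n_1}$ satisfies $g_n(q_n)=q_n$ and $|g_n'|<1$ on $J_n$. Moreover, for each $n\ge 1$ there exist an integer $R_n\ge1$, a map $T_{R_n}$ which is a composition of $R_n$ maps from $\{f_1,\dots,f_k\}$, and an integer $k_n\ge 2$ such that $g_n=T_{R_n}\circ g_{n-1}^{k_n}$. This equality is understood at the level of words: the word $\omega^n_1\dots\omega^n_{\pi_n}$ is $k_n$ consecutive copies of $\omega^{n-1}_1\dots\omega^{n-1}_{\pi_{n-1}}$ followed by a word $\alpha_n$ of length $R_n$ (the word defining $T_{R_n}$); in particular $\pi_n=k_n\pi_{n-1}+R_n$. (4) The sequence $\lambda_n=\frac{R_n}{k_n\pi_{n-1}}$, $n\ge1$, is summable. GIKN measures (measures produced by the construction of Gorodetski, Ilyashenko, Kleptsyn and Nalsky). A GIKN measure is an ergodic $T$-invariant probability measure $\mu$ on $M$ which is the weak-star limit of the measures $\mu_{X_n}=\frac1{\pi_n}\sum_{\ell=0}^{\pi_n-1}\delta_{T^\ell(\xi_n,q_n)}$, where $X_n=O((\xi_n,q_n))$ is a sequence of $T$-periodic orbits with repetitive pattern (with data $J_n,g_n,R_n,k_n,\pi_n$ as in the definition) which moreover satisfies, with $\chi_n=\frac1{\pi_n}\log|g_n'(q_n)|$ the fiber Lyapunov exponent of $X_n$: (i) $\chi_0<0$ and $\chi_n/2\le\chi_{n+1}<0$ for all $n\ge0$; (ii) for all $n\ge 0$, $g_{n+1}(J_n)\subset J_n$ and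 $|g_{n+1}'|<1$ on $J_n$, and $q_{n+1}\in J_n$; (iii) there is a constant $C=C(f_1,\dots,f_k)$ with $\frac{R_{n+1}}{k_{n+1}\pi_n}\le C|\chi_n|$ for all $n\ge0$; (iv) there is a summable sequence $(\gamma_n)$ with $(\max_j\max_{\mathbb{S}^1}|f_j'|)^{\pi_n}|J_n|<\gamma_n$ for all $n$. Disintegration. Let $\pi:M\to\Sigma_k$ be the projection, $\nu=\pi_\star\mu$, and let $\{\mu_\xi\}_{\xi\in\Sigma_k}$ be the ($\nu$-a.e. unique) family of conditional probability measures with $\mu_\xi(\{\xi\}\times\mathbb{S}^1)=1$ and $\mu(A)=\int_{\Sigma_k}\mu_\xi(A)\,d\nu(\xi)$ for Borel $A\subset M$. The measure $\mu$ has atomic disintegration with respect to the vertical fibers if for $\nu$-almost every $\xi$ the measure $\mu_\xi$ is atomic, i.e. a countable sum of point masses. *)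

theory Defs
  imports "HOL-Probability.Probability"
begin

section \<open>The circle\<close>

abbreviation circle :: "complex set" where
  "circle \<equiv> sphere 0 1"

text \<open>
  The circle is parametrised by arc length through \<^term>\<open>cis\<close>. As it is an embedded submanifold
  of the plane, a self-map \<open>f\<close> of the circle is \<open>C\<^sup>1\<close> iff \<open>f \<circ> cis\<close> is \<open>C\<^sup>1\<close> as a map from
  the reals to the plane.
\<close>

definition circle_C1 :: "(complex \<Rightarrow> complex) \<Rightarrow> bool" where
  "circle_C1 f \<longleftrightarrow> f ` circle \<subseteq> circle \<and> (f \<circ> cis) C1_differentiable_on UNIV"

definition circle_C1_diffeo :: "(complex \<Rightarrow> complex) \<Rightarrow> bool" where
  "circle_C1_diffeo f \<longleftrightarrow>
     bij_betw f circle circle \<and> circle_C1 f \<and> circle_C1 (the_inv_into circle f)"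

text \<open>
  The absolute value \<open>\<bar>f' x\<bar>\<close> of the derivative of a circle map with respect to arc length: if
  \<open>F\<close> is a lift of \<open>f\<close>, that is \<open>f (cis t) = cis (F t)\<close>, then the velocity of \<open>f \<circ> cis\<close>
  at \<open>t\<close> is \<open>\<i> F'(t) cis (F t)\<close>, of norm \<open>\<bar>F'(t)\<bar>\<close>. On the circle, \<open>cis (Arg x) = x\<close>.
\<close>

definition abs_deriv :: "(complex \<Rightarrow> complex) \<Rightarrow> complex \<Rightarrow> real" where
  "abs_deriv f x = norm (vector_derivative (f \<circ> cis) (at (Arg x)))"

text \<open>
  Open, closed, half-open and degenerate intervals are all allowed, and so is the whole circle.
\<close>

definition circle_interval :: "complex set \<Rightarrow> bool" where
  "circle_interval J \<longleftrightarrow> (\<exists>I. is_interval (I :: real set) \<and> J = cis ` I)"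

definition arc_length :: "complex set \<Rightarrow> real" where
  "arc_length J = measure lborel {t \<in> {0..<2 * pi}. cis t \<in> J}"

section \<open>The shift space and the skew product\<close>

text \<open>
  Both carrier sets below inherit their topology from the ambient types: \<^typ>\<open>int \<Rightarrow> nat\<close>
  carries the product of the discrete topologies.
\<close>

definition shift_space :: "nat \<Rightarrow> (int \<Rightarrow> nat) set" where
  "shift_space k = {\<xi>. \<forall>j. \<xi> j \<in> {1..k}}"

definition left_shift :: "(int \<Rightarrow> nat) \<Rightarrow> (int \<Rightarrow> nat)" where
  "left_shift \<xi> = (\<lambda>j. \<xi> (j + 1))"

definition skew_space :: "nat \<Rightarrow> ((int \<Rightarrow> nat) \<times> complex) set" where
  "skew_space k = shift_space k \<times> circle"

definition skew_product ::
  "(nat \<Rightarrow> complex \<Rightarrow> complex) \<Rightarrow> (int \<Rightarrow> nat) \<times> complex \<Rightarrow> (int \<Rightarrow> nat) \<times> complex" where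
  "skew_product f = (\<lambda>(\<xi>, x). (left_shift \<xi>, f (\<xi> 0) x))"

abbreviation skew_borel :: "nat \<Rightarrow> ((int \<Rightarrow> nat) \<times> complex) measure" where
  "skew_borel k \<equiv> restrict_space borel (skew_space k)"

definition generated_by :: "nat list \<Rightarrow> int \<Rightarrow> nat" where
  "generated_by w = (\<lambda>j. w ! nat (j mod int (length w)))"

text \<open>
  Note that \<^term>\<open>fold f [a\<^sub>1, a\<^sub>2, a\<^sub>3] = f a\<^sub>3 \<circ> f a\<^sub>2 \<circ> f a\<^sub>1\<close>: the first letter of the word
  acts first.
\<close>

abbreviation word_map :: "(nat \<Rightarrow> complex \<Rightarrow> complex) \<Rightarrow> nat list \<Rightarrow> complex \<Rightarrow> complex" where
  "word_map f w \<equiv> fold f w"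

section \<open>Repetitive patterns\<close>

text \<open>
  The \<open>n\<close>-th periodic orbit is that of \<open>(generated_by (w n), q n)\<close>, and \<open>J\<close> are the
  intervals. For \<open>n \<ge> 1\<close> the word \<open>w n\<close> is \<open>m n\<close> copies of \<open>w (n - 1)\<close> followed by the tail
  \<open>\<alpha> n\<close>, so that \<open>\<pi>\<^sub>n\<close>, \<open>R\<^sub>n\<close>, \<open>k\<^sub>n\<close> and \<open>g\<^sub>n\<close> are \<open>length (w n)\<close>, \<open>length (\<alpha> n)\<close>, \<open>m n\<close> and
  \<open>word_map f (w n)\<close>; the values \<open>m 0\<close> and \<open>\<alpha> 0\<close> are never used.
\<close>

definition tail_ratio :: "(nat \<Rightarrow> nat list) \<Rightarrow> (nat \<Rightarrow> nat) \<Rightarrow> (nat \<Rightarrow> nat list) \<Rightarrow> nat \<Rightarrow> real" where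
  "tail_ratio w m \<alpha> n = real (length (\<alpha> n)) / (real (m n) * real (length (w (n - 1))))"

definition repetitive_pattern ::
  "nat \<Rightarrow> (nat \<Rightarrow> complex \<Rightarrow> complex) \<Rightarrow> (nat \<Rightarrow> nat list) \<Rightarrow> (nat \<Rightarrow> complex) \<Rightarrow>
   (nat \<Rightarrow> complex set) \<Rightarrow> (nat \<Rightarrow> nat) \<Rightarrow> (nat \<Rightarrow> nat list) \<Rightarrow> bool" where
  "repetitive_pattern k f w q J m \<alpha> \<longleftrightarrow>
     (\<forall>n. w n \<noteq> [] \<and> set (w n) \<subseteq> {1..k}) \<and>
     (\<forall>n. (skew_product f ^^ length (w n)) (generated_by (w n), q n) = (generated_by (w n), q n)) \<and>
     (\<forall>n. circle_interval (J n) \<and> q n \<in> J n \<and> J (Suc n) \<subseteq> J n \<and>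
          0 < arc_length (J (Suc n)) \<and> arc_length (J (Suc n)) < arc_length (J n)) \<and>
     (\<lambda>n. arc_length (J n)) \<longlonglongrightarrow> 0 \<and>
     disjoint_family_on (\<lambda>l. word_map f (take l (w 0)) ` J 0) {..<length (w 0)} \<and>
     (\<forall>n. word_map f (w n) (q n) = q n \<and> (\<forall>x \<in> J n. abs_deriv (word_map f (w n)) x < 1)) \<and>
     (\<forall>n \<ge> 1. m n \<ge> 2 \<and> length (\<alpha> n) \<ge> 1 \<and>
          w n = concat (replicate (m n) (w (n - 1))) @ \<alpha> n) \<and>
     summable (\<lambda>n. tail_ratio w m \<alpha> (Suc n))"

section \<open>GIKN measures\<close>

definition invariant_measure :: "('a \<Rightarrow> 'a) \<Rightarrow> 'a measure \<Rightarrow> bool" where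
  "invariant_measure T \<mu> \<longleftrightarrow> T \<in> \<mu> \<rightarrow>\<^sub>M \<mu> \<and> distr \<mu> \<mu> T = \<mu>"

definition ergodic_measure :: "('a \<Rightarrow> 'a) \<Rightarrow> 'a measure \<Rightarrow> bool" where
  "ergodic_measure T \<mu> \<longleftrightarrow> prob_space \<mu> \<and> invariant_measure T \<mu> \<and>
     (\<forall>A \<in> sets \<mu>. T -` A \<inter> space \<mu> = A \<longrightarrow> measure \<mu> A = 0 \<or> measure \<mu> A = 1)"

definition orbit_measure ::
  "nat \<Rightarrow> (nat \<Rightarrow> complex \<Rightarrow> complex) \<Rightarrow> nat \<Rightarrow> (int \<Rightarrow> nat) \<times> complex \<Rightarrow>
   ((int \<Rightarrow> nat) \<times> complex) measure" where
  "orbit_measure k f p z =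
     distr (uniform_count_measure {..<p}) (skew_borel k) (\<lambda>l. (skew_product f ^^ l) z)"

text \<open>As \<^term>\<open>skew_space k\<close> is compact, every continuous test function is bounded.\<close>

definition weak_star_limit ::
  "nat \<Rightarrow> (nat \<Rightarrow> ((int \<Rightarrow> nat) \<times> complex) measure) \<Rightarrow> ((int \<Rightarrow> nat) \<times> complex) measure \<Rightarrow> bool" where
  "weak_star_limit k \<mu>s \<mu> \<longleftrightarrow>
     (\<forall>\<phi> :: (int \<Rightarrow> nat) \<times> complex \<Rightarrow> real. continuous_on (skew_space k) \<phi> \<longrightarrow>
        (\<lambda>n. \<integral>z. \<phi> z \<partial>(\<mu>s n)) \<longlonglongrightarrow> (\<integral>z. \<phi> z \<partial>\<mu>))"

definition fiber_exponent :: "(nat \<Rightarrow> complex \<Rightarrow> complex) \<Rightarrow> nat list \<Rightarrow> complex \<Rightarrow> real" where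
  "fiber_exponent f w x = ln (abs_deriv (word_map f w) x) / real (length w)"

definition GIKN_conditions ::
  "nat \<Rightarrow> (nat \<Rightarrow> complex \<Rightarrow> complex) \<Rightarrow> (nat \<Rightarrow> nat list) \<Rightarrow> (nat \<Rightarrow> complex) \<Rightarrow>
   (nat \<Rightarrow> complex set) \<Rightarrow> (nat \<Rightarrow> nat) \<Rightarrow> (nat \<Rightarrow> nat list) \<Rightarrow> bool" where
  "GIKN_conditions k f w q J m \<alpha> \<longleftrightarrow>
     fiber_exponent f (w 0) (q 0) < 0 \<and>
     (\<forall>n. fiber_exponent f (w n) (q n) / 2 \<le> fiber_exponent f (w (Suc n)) (q (Suc n)) \<and>
          fiber_exponent f (w (Suc n)) (q (Suc n)) < 0) \<and>
     (\<forall>n. word_map f (w (Suc n)) ` J n \<subseteq> J n \<and>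
          (\<forall>x \<in> J n. abs_deriv (word_map f (w (Suc n))) x < 1) \<and> q (Suc n) \<in> J n) \<and>
     (\<exists>C. \<forall>n. tail_ratio w m \<alpha> (Suc n) \<le> C * \<bar>fiber_exponent f (w n) (q n)\<bar>) \<and>
     (\<exists>\<gamma>. summable \<gamma> \<and>
          (\<forall>n. (MAX j\<in>{1..k}. SUP x\<in>circle. abs_deriv (f j) x) ^ length (w n) * arc_length (J n)
                 < \<gamma> n))"

definition GIKN_measure ::
  "nat \<Rightarrow> (nat \<Rightarrow> complex \<Rightarrow> complex) \<Rightarrow> ((int \<Rightarrow> nat) \<times> complex) measure \<Rightarrow> bool" where
  "GIKN_measure k f \<mu> \<longleftrightarrow>
     sets \<mu> = sets (skew_borel k) \<and>
     ergodic_measure (skew_product f) \<mu> \<and>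
     (\<exists>w q J m \<alpha>. repetitive_pattern k f w q J m \<alpha> \<and> GIKN_conditions k f w q J m \<alpha> \<and>
        weak_star_limit k (\<lambda>n. orbit_measure k f (length (w n)) (generated_by (w n), q n)) \<mu>)"

section \<open>Disintegration along the vertical fibers\<close>

definition base_measure ::
  "nat \<Rightarrow> ((int \<Rightarrow> nat) \<times> complex) measure \<Rightarrow> (int \<Rightarrow> nat) measure" where
  "base_measure k \<mu> = distr \<mu> (restrict_space borel (shift_space k)) fst"

definition fiber_disintegration ::
  "nat \<Rightarrow> ((int \<Rightarrow> nat) \<times> complex) measure \<Rightarrow>
   ((int \<Rightarrow> nat) \<Rightarrow> ((int \<Rightarrow> nat) \<times> complex) measure) \<Rightarrow> bool" where
  "fiber_disintegration k \<mu> \<kappa> \<longleftrightarrow>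
     \<kappa> \<in> base_measure k \<mu> \<rightarrow>\<^sub>M prob_algebra (skew_borel k) \<and>
     (\<forall>\<xi> \<in> shift_space k. emeasure (\<kappa> \<xi>) ({\<xi>} \<times> circle) = 1) \<and>
     (\<forall>A \<in> sets (skew_borel k). emeasure \<mu> A = (\<integral>\<^sup>+ \<xi>. emeasure (\<kappa> \<xi>) A \<partial>(base_measure k \<mu>)))"

text \<open>A countable sum of point masses; finite sums arise from vanishing weights.\<close>

definition atomic_measure :: "'a measure \<Rightarrow> bool" where
  "atomic_measure N \<longleftrightarrow>
     (\<exists>(p :: nat \<Rightarrow> 'a) (c :: nat \<Rightarrow> ennreal). range p \<subseteq> space N \<and>
        (\<forall>A \<in> sets N. emeasure N A = (\<Sum>i. c i * indicator A (p i))))"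

text \<open>
  Disintegrations exist and are unique up to a null set of base points, so that quantifying
  existentially or universally over them amounts to the same; requiring both makes the notion
  independent of this fact.
\<close>

definition atomic_disintegration :: "nat \<Rightarrow> ((int \<Rightarrow> nat) \<times> complex) measure \<Rightarrow> bool" where
  "atomic_disintegration k \<mu> \<longleftrightarrow>
     (\<exists>\<kappa>. fiber_disintegration k \<mu> \<kappa>) \<and>
     (\<forall>\<kappa>. fiber_disintegration k \<mu> \<kappa> \<longrightarrow> (AE \<xi> in base_measure k \<mu>. atomic_measure (\<kappa> \<xi>)))"

end

theory Submission
  imports Defs
begin

text \<open>
  Write \<open>\<xi>\<^sub>n\<close> for the base point of the \<open>n\<close>-th periodic orbit. As \<open>g\<^sub>n\<close> contracts \<open>J\<^sub>n\<^sub>-\<^sub>1\<close> into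
  itself, the orbit \<open>X\<^sub>n\<^sub>+\<^sub>1\<close> is \<open>\<gamma>\<^sub>n\<close>-close to \<open>X\<^sub>n\<close> except along its tail, so that for every \<open>n\<close> the
  measure \<open>\<mu>\<close> is, up to \<open>\<Sum>\<^sub>i\<^sub>>\<^sub>n \<lambda>\<^sub>i\<close>, carried by the closed set \<open>D\<^sub>n\<close> of the points \<open>(\<xi>, x)\<close> such that
  \<open>\<xi>\<close> reads \<open>w\<^sub>n w\<^sub>n\<close> around the origin, which is at offset \<open>l\<close> within one of the two copies, and \<open>x\<close> is close to \<open>f\<^sup>l(q\<^sub>n)\<close>.
  Two admissible offsets \<open>l\<close> over the same \<open>\<xi>\<close> differ by a period of \<open>\<xi>\<^sub>n\<close>. If for infinitely many \<open>n\<close>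
  the sequence \<open>\<xi>\<^sub>n\<close> has no period up to \<open>\<pi>\<^sub>n / 4\<close>, the fibers of these \<open>D\<^sub>n\<close> are covered by eight
  shrinking balls, and the Borel-Cantelli lemma yields a set of full measure with countable fibers.
  Otherwise \<open>\<xi>\<^sub>n\<close> and \<open>\<xi>\<^sub>n\<^sub>-\<^sub>1\<close> are periodic sequences agreeing on a window longer than the sum of their
  periods, hence equal; then \<open>g\<^sub>n\<close> and \<open>g\<^sub>n\<^sub>-\<^sub>1\<close> commute, which forces \<open>q\<^sub>n = q\<^sub>n\<^sub>-\<^sub>1\<close>, and \<open>\<mu>\<close> is carried by
  a periodic orbit.
\<close>

section \<open>Circle maps and their lifts\<close>

text \<open>Lifts to the line reduce metric estimates on the circle to the mean value theorem:
  rotation angles become differences of reals and \<open>abs_deriv\<close> becomes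
  \<open>\<bar>F' t\<bar>\<close>, see \<open>abs_deriv_lift\<close>.\<close>

definition circle_lift :: "(complex \<Rightarrow> complex) \<Rightarrow> (real \<Rightarrow> real) \<Rightarrow> (real \<Rightarrow> real) \<Rightarrow> bool" where
  "circle_lift g F F' \<longleftrightarrow>
     (\<forall>t. g (cis t) = cis (F t)) \<and> (\<forall>t. (F has_real_derivative F' t) (at t))"

lemma cis_eq_cis_iff: "cis a = cis b \<longleftrightarrow> (\<exists>n::int. a = b + 2 * pi * n)"
  using sin_cos_eq_iff[of a b] by (auto simp: complex_eq_iff)

lemma cis_inj_near: "cis a = cis b \<Longrightarrow> \<bar>a - b\<bar> < 2 * pi \<Longrightarrow> a = b"
proof -
  assume "cis a = cis b" and less: "\<bar>a - b\<bar> < 2 * pi"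
  then obtain n :: int where n: "a = b + 2 * pi * n"
    using cis_eq_cis_iff by blast
  with less have "2 * pi * \<bar>real_of_int n\<bar> < 2 * pi * 1" by (simp add: abs_mult)
  then have "\<bar>real_of_int n\<bar> < 1" by (subst (asm) mult_less_cancel_left_pos) auto
  then have "n = 0" by linarith
  with n show ?thesis by simp
qed

lemma cis_Arg_circle: "x \<in> circle \<Longrightarrow> cis (Arg x) = x"
  by (cases "x = 0") (auto simp: cis_Arg sgn_div_norm)

lemma circle_eq_range_cis: "circle = range cis"
proof
  show "circle \<subseteq> range cis"
    using cis_Arg_circle by (metis rangeI subsetI)
qed auto

lemma has_vector_derivative_cis: "(cis has_vector_derivative \<i> * cis t) (at t)"
proof -
  have "(cis has_derivative (\<lambda>h. (\<i> * cis t) * of_real h)) (at t)"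
    by (auto intro!: derivative_eq_intros simp: fun_eq_iff scaleR_conv_of_real mult_ac)
  then show ?thesis
    by (simp add: has_vector_derivative_def scaleR_conv_of_real mult_ac)
qed

lemma has_vector_derivative_cis_compose:
  assumes "(F has_real_derivative D) (at t)"
  shows "((\<lambda>t. cis (F t)) has_vector_derivative of_real D * (\<i> * cis (F t))) (at t)"
proof -
  have "((cis \<circ> F) has_vector_derivative D *\<^sub>R (\<i> * cis (F t))) (at t)"
    by (intro vector_diff_chain_at has_vector_derivative_cis
        assms[unfolded has_real_derivative_iff_has_vector_derivative])
  then show ?thesis by (simp add: o_def scaleR_conv_of_real)
qed

text \<open>The velocity of a curve in the circle is \<open>\<i> * \<theta> * h\<close> with
  \<open>\<theta>\<close> real and continuous. An antiderivative \<open>G\<close> of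
  \<open>\<theta>\<close> makes \<open>h * cis (- G)\<close> constant, and the argument of that
  constant is absorbed into the lift.\<close>

lemma circle_curve_has_lift:
  assumes C1: "h C1_differentiable_on UNIV" and circ: "\<And>t. h t \<in> circle"
  obtains F F' where "\<And>t. h t = cis (F t)" and "\<And>t. (F has_real_derivative F' t) (at t)"
proof -
  obtain D where D: "\<And>t. (h has_vector_derivative D t) (at t)" and contD: "continuous_on UNIV D"
    using C1 unfolding C1_differentiable_on_def by auto
  define \<theta> where "\<theta> t = Im (D t * cnj (h t))" for t
  have conth: "continuous_on UNIV h"
    using D by (meson continuous_at_imp_continuous_on has_vector_derivative_continuous)
  have "continuous_on UNIV \<theta>"
    unfolding \<theta>_def by (intro continuous_intros contD conth)
  then have cont\<theta>: "isCont \<theta> t" for t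
    by (simp add: continuous_on_eq_continuous_at)
  obtain G where G: "\<And>t. (G has_vector_derivative \<theta> t) (at t)"
    using einterval_antiderivative[of "-\<infinity>" "\<infinity>" \<theta>] cont\<theta> by auto
  have unit: "h t * cnj (h t) = 1" for t
    using circ[of t] by (simp add: complex_norm_square[symmetric])
  have tangent: "D t = \<i> * of_real (\<theta> t) * h t" for t
  proof -
    \<comment> \<open>Differentiating \<open>h * cnj h = 1\<close> in two ways shows that the radial
      part of the velocity vanishes.\<close>
    have "((\<lambda>t. h t * cnj (h t)) has_vector_derivative (h t * cnj (D t) + D t * cnj (h t))) (at t)"
      by (intro has_vector_derivative_mult D has_vector_derivative_cnj)
    moreover have "((\<lambda>t. h t * cnj (h t)) has_vector_derivative 0) (at t)"
      unfolding unit by (rule has_vector_derivative_const)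
    ultimately have "h t * cnj (D t) + D t * cnj (h t) = 0"
      by (rule vector_derivative_unique_at)
    then have "Re (D t * cnj (h t)) = 0" by (simp add: complex_eq_iff)
    then have "D t * cnj (h t) = \<i> * of_real (\<theta> t)"
      by (simp add: complex_eq_iff \<theta>_def)
    then have "D t * (cnj (h t) * h t) = \<i> * of_real (\<theta> t) * h t" by (simp add: mult_ac)
    then show ?thesis using unit[of t] by (simp add: mult.commute)
  qed
  have zero: "((\<lambda>t. h t * cis (- G t)) has_vector_derivative 0) (at t)" for t
  proof -
    have "((\<lambda>t. - G t) has_real_derivative - \<theta> t) (at t)"
      using G by (auto intro!: derivative_intros simp: has_real_derivative_iff_has_vector_derivative)
    from has_vector_derivative_mult[OF D[of t] has_vector_derivative_cis_compose[OF this]]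
    show ?thesis by (simp add: tangent mult_ac)
  qed
  obtain c where c: "\<And>t. h t * cis (- G t) = c"
    using has_vector_derivative_zero_constant[OF convex_UNIV, of "\<lambda>t. h t * cis (- G t)"]
      has_vector_derivative_at_within[OF zero] by auto
  have h: "h t = c * cis (G t)" for t
    using c[of t] by (metis cis_cnj cis_inverse cis_neq_zero mult.assoc mult.right_neutral
        right_inverse mult.commute minus_minus)
  have "norm c = 1" using c[of 0] circ[of 0] by (metis dist_0_norm mem_sphere norm_cis norm_mult mult_1_right)
  then have "c = cis (Arg c)" by (simp add: cis_Arg_circle)
  with h have "h t = cis (G t + Arg c)" for t by (metis cis_mult mult.commute)
  moreover have "((\<lambda>t. G t + Arg c) has_real_derivative \<theta> t) (at t)" for t
    using G by (auto intro!: derivative_eq_intros simp: has_real_derivative_iff_has_vector_derivative[symmetric])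
  ultimately show ?thesis by (rule that)
qed

lemma circle_lift_exists:
  assumes "circle_C1 g"
  obtains F F' where "circle_lift g F F'"
proof -
  have "(g \<circ> cis) t \<in> circle" for t
    using assms unfolding circle_C1_def by (metis comp_apply circle_eq_range_cis image_subset_iff rangeI)
  then obtain F F' where "\<And>t. (g \<circ> cis) t = cis (F t)" "\<And>t. (F has_real_derivative F' t) (at t)"
    using circle_curve_has_lift[of "g \<circ> cis"] assms unfolding circle_C1_def by metis
  then show ?thesis using that unfolding circle_lift_def by auto
qed

lemma circle_lift_id: "circle_lift id (\<lambda>t. t) (\<lambda>_. 1)"
  by (auto simp: circle_lift_def)

lemma circle_lift_compose:
  assumes "circle_lift g F F'" and "circle_lift h G G'"
  shows "circle_lift (h \<circ> g) (\<lambda>t. G (F t)) (\<lambda>t. G' (F t) * F' t)"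
  using assms unfolding circle_lift_def by (auto intro: DERIV_chain2)

lemma circle_lift_maps: "circle_lift g F F' \<Longrightarrow> x \<in> circle \<Longrightarrow> g x \<in> circle"
  unfolding circle_lift_def circle_eq_range_cis by auto

lemma norm_vector_derivative_lift:
  assumes "circle_lift g F F'"
  shows "norm (vector_derivative (g \<circ> cis) (at t)) = \<bar>F' t\<bar>"
proof -
  have "g \<circ> cis = (\<lambda>t. cis (F t))" using assms by (auto simp: circle_lift_def)
  moreover have "((\<lambda>t. cis (F t)) has_vector_derivative of_real (F' t) * (\<i> * cis (F t))) (at t)"
    using assms by (intro has_vector_derivative_cis_compose) (auto simp: circle_lift_def)
  ultimately show ?thesis by (simp add: vector_derivative_at norm_mult)
qed

text \<open>\<open>abs_deriv\<close> evaluates the derivative at \<open>Arg (cis t)\<close>, which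
  differs from \<open>t\<close> by a multiple of \<open>2 * pi\<close>; since
  \<open>g \<circ> cis\<close> is periodic, its derivatives at the two places agree.\<close>

lemma abs_deriv_lift:
  assumes lift: "circle_lift g F F'"
  shows "abs_deriv g (cis t) = \<bar>F' t\<bar>"
proof -
  have "cis (Arg (cis t)) = cis t" by (simp add: cis_Arg_circle)
  then obtain n :: int where n: "Arg (cis t) = t + 2 * pi * n" using cis_eq_cis_iff by blast
  define c where "c = 2 * pi * n"
  have shift: "(g \<circ> cis) \<circ> (\<lambda>s. s + c) = g \<circ> cis"
    by (auto simp: fun_eq_iff c_def cis_mult[symmetric])
  have "((g \<circ> cis) has_vector_derivative vector_derivative (g \<circ> cis) (at (t + c))) (at (t + c))"
  proof -
    have "((g \<circ> cis) has_vector_derivative of_real (F' (t + c)) * (\<i> * cis (F (t + c)))) (at (t + c))"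
      using lift has_vector_derivative_cis_compose[of F "F' (t + c)" "t + c"]
      unfolding circle_lift_def by (auto simp: o_def)
    then show ?thesis by (simp add: vector_derivative_at)
  qed
  moreover have "((\<lambda>s. s + c) has_vector_derivative 1) (at t)"
    by (auto intro!: derivative_eq_intros)
  ultimately have "(((g \<circ> cis) \<circ> (\<lambda>s. s + c)) has_vector_derivative
      1 *\<^sub>R vector_derivative (g \<circ> cis) (at (t + c))) (at t)"
    by (intro vector_diff_chain_at) auto
  then have "vector_derivative (g \<circ> cis) (at t) = vector_derivative (g \<circ> cis) (at (t + c))"
    unfolding shift by (simp add: vector_derivative_at)
  then show ?thesis
    using norm_vector_derivative_lift[OF lift, of t] by (simp add: abs_deriv_def n c_def)
qed

text \<open>Without boundedness a real supremum says nothing, so this is what makes the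
  \<open>SUP\<close> inside \<open>L\<close> an actual bound. \<open>Arg\<close> has values in the
  compact interval \<open>{-pi..pi}\<close>, on which the derivative is continuous.\<close>

lemma bdd_above_abs_deriv:
  assumes "circle_C1 g"
  shows "bdd_above (abs_deriv g ` circle)"
proof -
  have "continuous_on UNIV (\<lambda>t. vector_derivative (g \<circ> cis) (at t))"
    using assms unfolding circle_C1_def C1_differentiable_on_eq by blast
  then have "compact ((\<lambda>t. norm (vector_derivative (g \<circ> cis) (at t))) ` {-pi..pi})"
    by (intro compact_continuous_image continuous_intros) (auto intro: continuous_on_subset)
  then have "bdd_above ((\<lambda>t. norm (vector_derivative (g \<circ> cis) (at t))) ` {-pi..pi})"
    by (simp add: compact_imp_bounded bounded_imp_bdd_above)
  moreover have "abs_deriv g ` circle \<subseteq> (\<lambda>t. norm (vector_derivative (g \<circ> cis) (at t))) ` {-pi..pi}"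
    unfolding abs_deriv_def using Arg_bounded by (force simp: less_imp_le)
  ultimately show ?thesis by (rule bdd_above_mono)
qed

lemma circle_lift_lipschitz:
  assumes "circle_lift g F F'" and "\<And>t. \<bar>F' t\<bar> \<le> L"
  shows "\<bar>F s - F t\<bar> \<le> L * \<bar>s - t\<bar>"
  using field_differentiable_bound[of UNIV F F' L t s] assms
  by (auto simp: circle_lift_def abs_minus_commute)

text \<open>The derivative is below 1 only pointwise, so the mean value theorem yields a strict
  decrease but no uniform rate.\<close>

lemma circle_lift_contraction:
  assumes lift: "circle_lift g F F'" and small: "\<And>u. min s t \<le> u \<Longrightarrow> u \<le> max s t \<Longrightarrow> \<bar>F' u\<bar> < 1"
    and "s \<noteq> t"
  shows "\<bar>F s - F t\<bar> < \<bar>s - t\<bar>"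
proof -
  have *: "\<bar>F b - F a\<bar> < \<bar>b - a\<bar>" if "a < b" and "\<And>u. a \<le> u \<Longrightarrow> u \<le> b \<Longrightarrow> \<bar>F' u\<bar> < 1" for a b
  proof -
    obtain z where "a < z" "z < b" "F b - F a = (b - a) * F' z"
      using MVT2[of a b F F'] \<open>a < b\<close> lift unfolding circle_lift_def by blast
    moreover from this have "\<bar>F' z\<bar> < 1" using that(2)[of z] by linarith
    ultimately show ?thesis using \<open>a < b\<close> by (simp add: abs_mult)
  qed
  show ?thesis
    using *[of s t] *[of t s] small \<open>s \<noteq> t\<close> by (cases "s < t") (auto simp: min_def max_def abs_minus_commute)
qed

text \<open>If \<open>L < 1\<close>, then \<open>F\<close> moves by less than \<open>pi\<close> from
  \<open>F 0\<close> on \<open>{-pi..pi}\<close>, and the point opposite to \<open>cis (F 0)\<close>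
  is missed. The bound makes the powers of \<open>L\<close> increasing in the word length.\<close>

lemma one_le_deriv_bound:
  assumes lift: "circle_lift g F F'" and bound: "\<And>t. \<bar>F' t\<bar> \<le> L" and surj: "g ` circle = circle"
  shows "1 \<le> L"
proof (rule ccontr)
  assume "\<not> 1 \<le> L"
  have "cis (F 0 + pi) \<in> g ` circle" using surj by simp
  then obtain x where x: "x \<in> circle" "g x = cis (F 0 + pi)" by (metis imageE)
  define t where "t = Arg x"
  have t: "\<bar>t\<bar> \<le> pi" and "cis t = x"
    using Arg_bounded[of x] cis_Arg_circle[OF x(1)] by (auto simp: t_def)
  then have eq: "cis (F t) = cis (F 0 + pi)" using x(2) lift by (auto simp: circle_lift_def)
  have "0 \<le> L" using bound[of 0] by linarith
  have "\<bar>F t - F 0\<bar> \<le> L * \<bar>t\<bar>" using circle_lift_lipschitz[OF lift bound, of t 0] by simp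
  also have "\<dots> \<le> L * pi" using t \<open>0 \<le> L\<close> by (intro mult_left_mono)
  also have "\<dots> < pi" using \<open>\<not> 1 \<le> L\<close> pi_gt_zero by simp
  finally have "\<bar>F t - F 0\<bar> < pi" .
  moreover from this have "F t = F 0 + pi" using cis_inj_near[OF eq] by linarith
  ultimately show False by simp
qed

section \<open>Arc length of circle intervals and contraction along them\<close>

text \<open>A multiple \<open>c\<close> of \<open>2 * pi\<close> brings \<open>s\<close> into the
  fundamental domain. The segment up to \<open>t - c\<close> then either stays there or wraps around
  and appears as a final and an initial piece of \<open>{0..<2 * pi}\<close>.\<close>

lemma is_interval_arc_length:
  fixes I :: "real set"
  assumes I: "is_interval I" and "s \<in> I" "t \<in> I" "s \<le> t"
  shows "min (t - s) (2 * pi) \<le> arc_length (cis ` I)"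
proof -
  define n :: int where "n = \<lfloor>s / (2 * pi)\<rfloor>"
  define c where "c = 2 * pi * n"
  have "n \<le> s / (2 * pi)" "s / (2 * pi) < n + 1" unfolding n_def by linarith+
  then have s: "0 \<le> s - c" "s - c < 2 * pi" unfolding c_def by (auto simp: field_simps)
  define S where "S = {u \<in> {0..<2 * pi}. cis u \<in> cis ` I}"
  have S_eq: "S = {0..<2 * pi} \<inter> (\<Union>m::int. (\<lambda>u. u + 2 * pi * m) ` I)"
  proof -
    have "cis u \<in> cis ` I \<longleftrightarrow> u \<in> (\<Union>m::int. (\<lambda>v. v + 2 * pi * m) ` I)" for u
      unfolding image_iff cis_eq_cis_iff UN_iff by blast
    then show ?thesis unfolding S_def by (simp only: set_eq_iff Int_iff mem_Collect_eq simp_thms)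
  qed
  have "is_interval ((\<lambda>u. u + 2 * pi * m) ` I)" for m :: int
    using I is_interval_translation[of "2 * pi * m" I] by (simp add: add.commute)
  then have S_meas: "S \<in> sets lborel"
    unfolding S_eq by (auto intro!: sets.Int sets.countable_UN' simp: real_interval_borel_measurable)
  have fin: "S \<in> fmeasurable lborel"
  proof (rule fmeasurableI2[of "cbox 0 (2 * pi)"])
    show "cbox 0 (2 * pi) \<in> fmeasurable lborel" by (rule fmeasurable_cbox)
    show "S \<in> sets lborel" by (rule S_meas)
    show "S \<subseteq> cbox 0 (2 * pi)" by (auto simp: S_def)
  qed
  have mem: "cis u \<in> cis ` I" if "s \<le> u + 2 * pi * m" "u + 2 * pi * m \<le> t" for u and m :: int
  proof -
    have "u + 2 * pi * m \<in> I" using I that assms by (meson mem_is_interval_1_I)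
    moreover have "cis u = cis (u + 2 * pi * m)" by (simp add: cis_mult[symmetric])
    ultimately show ?thesis by blast
  qed
  show ?thesis
  proof (cases "t - c < 2 * pi")
    case True
    have "{s - c..t - c} \<subseteq> S"
      using True s mem[of _ n] by (auto simp: S_def c_def algebra_simps)
    then have "measure lborel {s - c..t - c} \<le> measure lborel S"
      by (intro measure_mono_fmeasurable fin) auto
    then show ?thesis using \<open>s \<le> t\<close> by (auto simp: arc_length_def S_def)
  next
    case False
    \<comment> \<open>The initial piece is capped at \<open>s - c\<close> to keep it disjoint from
      the final one; the cap accounts for the value \<open>2 * pi\<close> in the minimum.\<close>
    define v where "v = min (t - c - 2 * pi) (s - c)"
    have v: "0 \<le> v" "v \<le> s - c" using False s by (auto simp: v_def)
    have "{s - c..<2 * pi} \<subseteq> S"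
      using False s mem[of _ n] by (auto simp: S_def c_def algebra_simps)
    moreover have "{0..<v} \<subseteq> S"
      using False s mem[of _ "n + 1"] by (auto simp: S_def c_def v_def algebra_simps)
    ultimately have "measure lborel ({s - c..<2 * pi} \<union> {0..<v}) \<le> measure lborel S"
      by (intro measure_mono_fmeasurable fin) auto
    moreover have "measure lborel ({s - c..<2 * pi} \<union> {0..<v}) =
        measure lborel {s - c..<2 * pi} + measure lborel {0..<v}"
      using v s by (intro measure_Union) auto
    moreover have "measure lborel {0..<v} = v" "measure lborel {s - c..<2 * pi} = 2 * pi - (s - c)"
      using False s by (auto simp: v_def min_def)
    ultimately show ?thesis using \<open>s \<le> t\<close> False s by (auto simp: arc_length_def S_def v_def)
  qed
qed

lemma is_interval_short_arc:
  fixes I :: "real set"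
  assumes "is_interval I" "s \<in> I" "t \<in> I" "arc_length (cis ` I) < 2 * pi"
  shows "\<bar>t - s\<bar> \<le> arc_length (cis ` I)"
proof (cases "s \<le> t")
  case True
  then show ?thesis using is_interval_arc_length[of I s t] assms by linarith
next
  case False
  then show ?thesis using is_interval_arc_length[of I t s] assms by linarith
qed

text \<open>Closeness is measured by a rotation angle rather than by the chord: angles add up under
  composition and are multiplied by at most the Lipschitz constant of a lift.\<close>

definition arc_close :: "real \<Rightarrow> complex \<Rightarrow> complex \<Rightarrow> bool" where
  "arc_close r x y \<longleftrightarrow> (\<exists>\<delta>. \<bar>\<delta>\<bar> \<le> r \<and> y = x * cis \<delta>)"

lemma dist_cis_le: "dist (cis a) (cis b) \<le> \<bar>a - b\<bar>"
proof -
  have "norm (cis a - cis b) \<le> 1 * norm (a - b)"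
  proof (rule differentiable_bound[of UNIV])
    show "(cis has_derivative (\<lambda>h. h *\<^sub>R (\<i> * cis t))) (at t within UNIV)" for t
      using has_vector_derivative_cis[of t] by (simp add: has_vector_derivative_def)
    show "onorm (\<lambda>h. h *\<^sub>R (\<i> * cis t)) \<le> 1" for t :: real
      by (rule onorm_bound) (auto simp: norm_mult)
  qed auto
  then show ?thesis by (simp add: dist_norm)
qed

lemma arc_close_dist:
  assumes "arc_close r x y" and "x \<in> circle"
  shows "dist x y \<le> r"
proof -
  obtain \<delta> where \<delta>: "\<bar>\<delta>\<bar> \<le> r" "y = x * cis \<delta>" using assms by (auto simp: arc_close_def)
  have "x - y = x * (cis 0 - cis \<delta>)" by (simp add: \<delta> algebra_simps)
  then have "dist x y = norm x * dist (cis 0) (cis \<delta>)" by (metis dist_norm norm_mult)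
  also have "\<dots> \<le> 1 * \<bar>\<delta>\<bar>" using assms(2) dist_cis_le[of 0 \<delta>] by simp
  finally show ?thesis using \<delta> by simp
qed

lemma arc_close_trans: "arc_close r x y \<Longrightarrow> arc_close s y z \<Longrightarrow> arc_close (r + s) x z"
  unfolding arc_close_def
proof clarify
  fix a b assume "\<bar>a\<bar> \<le> r" "\<bar>b\<bar> \<le> s"
  then show "\<exists>\<delta>. \<bar>\<delta>\<bar> \<le> r + s \<and> x * cis a * cis b = x * cis \<delta>"
    by (intro exI[of _ "a + b"]) (auto simp: cis_mult mult.assoc)
qed

lemma arc_close_mono: "arc_close r x y \<Longrightarrow> r \<le> s \<Longrightarrow> arc_close s x y"
  unfolding arc_close_def by force

lemma arc_close_lipschitz:
  assumes lift: "circle_lift g F F'" and bound: "\<And>t. \<bar>F' t\<bar> \<le> L"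
    and "x \<in> circle" and "arc_close r x y"
  shows "arc_close (L * r) (g x) (g y)"
proof -
  obtain \<delta> where \<delta>: "\<bar>\<delta>\<bar> \<le> r" "y = x * cis \<delta>" using assms by (auto simp: arc_close_def)
  obtain t where t: "x = cis t" using \<open>x \<in> circle\<close> circle_eq_range_cis by auto
  have "g y = g x * cis (F (t + \<delta>) - F t)"
    using lift by (simp add: \<delta> t cis_mult circle_lift_def)
  moreover have "\<bar>F (t + \<delta>) - F t\<bar> \<le> L * \<bar>\<delta>\<bar>"
    using circle_lift_lipschitz[OF lift bound, of "t + \<delta>" t] by simp
  moreover have "L * \<bar>\<delta>\<bar> \<le> L * r" using \<delta> bound[of 0] by (intro mult_left_mono) auto
  ultimately show ?thesis unfolding arc_close_def by (meson order_trans)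
qed

lemma circle_interval_diameter:
  assumes "circle_interval J" "arc_length J < 2 * pi" and "x \<in> J" "y \<in> J"
  shows "arc_close (arc_length J) x y"
proof -
  obtain I s t where I: "is_interval I" "J = cis ` I" and "s \<in> I" "t \<in> I" "x = cis s" "y = cis t"
    using assms unfolding circle_interval_def by blast
  then have "\<bar>t - s\<bar> \<le> arc_length J"
    using is_interval_short_arc[of I s t] assms(2) by simp
  then show ?thesis unfolding arc_close_def using \<open>x = cis s\<close> \<open>y = cis t\<close>
    by (intro exI[of _ "t - s"]) (simp add: cis_mult)
qed

text \<open>The rotation from \<open>x\<close> to \<open>y\<close> by \<open>\<delta>\<close> must
  be the one that runs inside \<open>J\<close>, so that the derivative bound holds along the whole
  path and the lift contracts it.\<close>

lemma circle_interval_contraction: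
  assumes lift: "circle_lift g F F'" and J: "circle_interval J" "arc_length J < pi"
    and small: "\<And>x. x \<in> J \<Longrightarrow> abs_deriv g x < 1"
    and xy: "x \<in> J" "y \<in> J" and y: "y = x * cis \<delta>" "\<bar>\<delta>\<bar> < pi" "\<delta> \<noteq> 0"
  obtains \<delta>' where "\<bar>\<delta>'\<bar> < \<bar>\<delta>\<bar>" and "g y = g x * cis \<delta>'"
proof -
  obtain I s t where I: "is_interval I" "J = cis ` I" and st: "s \<in> I" "t \<in> I" "x = cis s" "y = cis t"
    using J xy unfolding circle_interval_def by blast
  moreover have "arc_length J < 2 * pi" using J(2) pi_gt_zero by linarith
  ultimately have "\<bar>t - s\<bar> \<le> arc_length J"
    using is_interval_short_arc[of I s t] I st by simp
  moreover have "cis t = cis (s + \<delta>)" using y st by (simp add: cis_mult)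
  \<comment> \<open>The bounds by \<open>pi\<close> on the arc and on \<open>\<delta>\<close> add up
    to \<open>2 * pi\<close>, which leaves a single candidate for the angle of
    \<open>y\<close>.\<close>
  moreover have "\<bar>t - (s + \<delta>)\<bar> < 2 * pi" using \<open>\<bar>t - s\<bar> \<le> arc_length J\<close> y(2) J(2) by linarith
  ultimately have t: "t = s + \<delta>" by (intro cis_inj_near)
  have "\<bar>F' u\<bar> < 1" if "min t s \<le> u" "u \<le> max t s" for u
  proof -
    have "u \<in> I"
    proof (cases "s \<le> t")
      case True
      then show ?thesis using that mem_is_interval_1_I[OF I(1) st(1,2)] by simp
    next
      case False
      then show ?thesis using that mem_is_interval_1_I[OF I(1) st(2,1)] by simp
    qed
    then have "cis u \<in> J" using I(2) by simp
    then show ?thesis using small[of "cis u"] abs_deriv_lift[OF lift, of u] by simp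
  qed
  then have "\<bar>F t - F s\<bar> < \<bar>t - s\<bar>" using t y(3) by (intro circle_lift_contraction[OF lift]) auto
  moreover have "g y = g x * cis (F t - F s)" using lift st by (simp add: circle_lift_def cis_mult)
  ultimately show ?thesis using t that by auto
qed

text \<open>The angle between two fixed points would be strictly shortened, yet it still joins the
  same points; angles below \<open>pi\<close> are determined by their endpoints.\<close>

lemma contraction_unique_fixpoint:
  assumes lift: "circle_lift g F F'" and J: "circle_interval J" "arc_length J < pi"
    and small: "\<And>x. x \<in> J \<Longrightarrow> abs_deriv g x < 1"
    and xy: "x \<in> J" "y \<in> J" and fixed: "g x = x" "g y = y"
  shows "x = y"
proof (rule ccontr)
  assume "x \<noteq> y"
  obtain \<delta> where \<delta>: "\<bar>\<delta>\<bar> \<le> arc_length J" "y = x * cis \<delta>"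
    using circle_interval_diameter[OF J(1) _ xy] J(2) pi_gt_zero unfolding arc_close_def by auto
  with \<open>x \<noteq> y\<close> have "\<delta> \<noteq> 0" by auto
  with \<delta> J obtain \<delta>' where \<delta>': "\<bar>\<delta>'\<bar> < \<bar>\<delta>\<bar>" "g y = g x * cis \<delta>'"
    using circle_interval_contraction[OF lift J small xy, of \<delta>] by auto
  have "x \<noteq> 0" using xy J(1) by (auto simp: circle_interval_def)
  then have "cis \<delta>' = cis \<delta>" using \<delta>' \<delta> fixed by auto
  then have "\<delta>' = \<delta>" using \<delta> \<delta>' J(2) by (intro cis_inj_near) auto
  with \<delta>' show False by simp
qed

text \<open>Each application shortens the angle to the fixed point \<open>x\<close>, or leaves it
  zero, so the initial bound \<open>r\<close> persists as long as the iterates remain in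
  \<open>J\<close>.\<close>

lemma contraction_iterates_close:
  assumes lift: "circle_lift g F F'" and J: "circle_interval J" "arc_length J < pi"
    and small: "\<And>x. x \<in> J \<Longrightarrow> abs_deriv g x < 1" and self: "g ` J \<subseteq> J"
    and xy: "x \<in> J" "y \<in> J" and fixed: "g x = x" and close: "arc_close r x y" "r < pi"
  shows "(g ^^ i) y \<in> J \<and> arc_close r x ((g ^^ i) y)"
proof (induction i)
  case 0
  then show ?case using xy close by simp
next
  case (Suc i)
  define z where "z = (g ^^ i) y"
  have z: "z \<in> J" "arc_close r x z" using Suc by (auto simp: z_def)
  then obtain \<delta> where \<delta>: "\<bar>\<delta>\<bar> \<le> r" "z = x * cis \<delta>" by (auto simp: arc_close_def)
  have "arc_close r x (g z)"
  proof (cases "\<delta> = 0")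
    case True
    then show ?thesis using \<delta> z fixed by auto
  next
    case False
    then obtain \<delta>' where "\<bar>\<delta>'\<bar> < \<bar>\<delta>\<bar>" "g z = g x * cis \<delta>'"
      using circle_interval_contraction[OF lift J small xy(1) z(1) \<delta>(2)] \<delta> close by auto
    then show ?thesis unfolding arc_close_def using \<delta> fixed by (intro exI[of _ \<delta>']) auto
  qed
  then show ?case using self z by (auto simp: z_def)
qed

section \<open>Disintegrations\<close>

lemma conull_countable_atomic:
  assumes C: "countable C" "C \<noteq> {}" "C \<subseteq> space N"
    and single: "\<And>x. x \<in> C \<Longrightarrow> {x} \<in> sets N"
    and null: "emeasure N (space N - C) = 0"
  shows "atomic_measure N"
proof -
  define p where "p = from_nat_into C"
  \<comment> \<open>Indices outside the range of \<open>to_nat_on C\<close> repeat points of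
    \<open>C\<close>; weight zero there prevents a point from being counted twice.\<close>
  define c where "c i = (if i \<in> to_nat_on C ` C then emeasure N {p i} else 0)" for i
  have p: "p i \<in> C" for i using C by (simp add: p_def from_nat_into)
  have CN: "C \<in> sets N" using single C(1) by (rule sets.countable)
  have "emeasure N A = (\<Sum>i. c i * indicator A (p i))" if A: "A \<in> sets N" for A
  proof -
    define B where "B i = (if i \<in> to_nat_on C ` C then A \<inter> {p i} else {})" for i
    have "A \<inter> C = (\<Union>i. B i)"
    proof
      show "A \<inter> C \<subseteq> (\<Union>i. B i)"
      proof
        fix x assume "x \<in> A \<inter> C"
        then have "x \<in> B (to_nat_on C x)" using C by (auto simp: B_def p_def)
        then show "x \<in> (\<Union>i. B i)" by blast
      qed
      show "(\<Union>i. B i) \<subseteq> A \<inter> C" using p by (auto simp: B_def)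
    qed
    moreover have "disjoint_family B"
      unfolding disjoint_family_on_def B_def p_def using C by (auto split: if_splits)
    moreover have B: "B i \<in> sets N" for i
      using single[OF p] A by (auto simp: B_def)
    ultimately have "emeasure N (A \<inter> C) = (\<Sum>i. emeasure N (B i))"
      by (metis image_subset_iff suminf_emeasure)
    moreover have "emeasure N A = emeasure N (A \<inter> C)"
    proof (rule antisym)
      have "emeasure N A \<le> emeasure N ((A \<inter> C) \<union> (space N - C))"
        using A CN sets.sets_into_space[OF A] by (intro emeasure_mono) auto
      also have "\<dots> \<le> emeasure N (A \<inter> C) + emeasure N (space N - C)"
        using A CN by (intro emeasure_subadditive) auto
      finally show "emeasure N A \<le> emeasure N (A \<inter> C)" using null by simp
    qed (use A in \<open>auto intro: emeasure_mono\<close>)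
    moreover have "emeasure N (B i) = c i * indicator A (p i)" for i
      by (auto simp: B_def c_def indicator_def)
    ultimately show ?thesis by simp
  qed
  moreover have "range p \<subseteq> space N" using p C by auto
  ultimately show ?thesis unfolding atomic_measure_def by blast
qed

section \<open>Regular conditional distributions of a bounded real variable\<close>

text \<open>The difference \<open>D\<close> of the two measures is again a measure, and the
  derivative of \<open>N2\<close> is the sum of those of \<open>N1\<close> and
  \<open>D\<close>.\<close>

lemma RN_deriv_mono:
  assumes "finite_measure M" and ac: "absolutely_continuous M N2"
    and sets: "sets N1 = sets M" "sets N2 = sets M" and fin: "finite_measure N1" "finite_measure N2"
    and le: "\<And>A. A \<in> sets M \<Longrightarrow> emeasure N1 A \<le> emeasure N2 A"
  shows "AE x in M. RN_deriv M N1 x \<le> RN_deriv M N2 x"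
proof -
  interpret finite_measure M by fact
  interpret N1: finite_measure N1 by fact
  interpret N2: finite_measure N2 by fact
  have ac1: "absolutely_continuous M N1"
    using ac le sets unfolding absolutely_continuous_def null_sets_def by fastforce
  define D where "D = diff_measure N2 N1"
  have D: "emeasure D A = emeasure N2 A - emeasure N1 A" if "A \<in> sets M" for A
    unfolding D_def using sets le that
    by (intro emeasure_diff_measure) (auto intro: fin)
  have setsD: "sets D = sets M" unfolding D_def using sets by simp
  have acD: "absolutely_continuous M D"
    using ac D setsD sets unfolding absolutely_continuous_def null_sets_def by fastforce
  have add: "density M (\<lambda>x. RN_deriv M N1 x + RN_deriv M D x) = N2"
  proof (rule measure_eqI)
    fix A assume "A \<in> sets (density M (\<lambda>x. RN_deriv M N1 x + RN_deriv M D x))"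
    then have A: "A \<in> sets M" by simp
    have "emeasure (density M (\<lambda>x. RN_deriv M N1 x + RN_deriv M D x)) A =
        emeasure (density M (RN_deriv M N1)) A + emeasure (density M (RN_deriv M D)) A"
      using A by (simp add: emeasure_density nn_integral_add[symmetric] distrib_right)
    also have "\<dots> = emeasure N1 A + (emeasure N2 A - emeasure N1 A)"
      using density_RN_deriv[OF ac1] density_RN_deriv[OF acD] sets setsD D A by simp
    also have "\<dots> = emeasure N2 A"
      using le[OF A] N1.emeasure_finite by (simp add: add_diff_inverse_ennreal diff_add_self_ennreal)
    finally show "emeasure (density M (\<lambda>x. RN_deriv M N1 x + RN_deriv M D x)) A = emeasure N2 A" .
  qed (simp add: sets)
  have "AE x in M. RN_deriv M N1 x + RN_deriv M D x = RN_deriv M N2 x"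
    by (rule RN_deriv_unique) (auto simp: add)
  then show ?thesis by eventually_elim (metis add_increasing2 order_refl zero_le)
qed

text \<open>The conditional distribution function is obtained at rational thresholds as a
  Radon-Nikodym derivative, corrected on a null set, made right continuous, and turned into a
  measure on the line. The joint law is then checked on the rectangles
  \<open>A \<times> {..t}\<close>.\<close>

lemma conditional_distribution_exists:
  fixes Y :: "'a \<Rightarrow> real"
  assumes "prob_space M" and X[measurable]: "X \<in> M \<rightarrow>\<^sub>M S" and Y[measurable]: "Y \<in> borel_measurable M"
    and bound: "\<And>\<omega>. \<omega> \<in> space M \<Longrightarrow> \<bar>Y \<omega>\<bar> \<le> K"
  obtains \<theta> where "\<theta> \<in> S \<rightarrow>\<^sub>M prob_algebra borel"
    and "distr M (S \<Otimes>\<^sub>M borel) (\<lambda>\<omega>. (X \<omega>, Y \<omega>)) =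
         distr M S X \<bind> (\<lambda>\<xi>. distr (\<theta> \<xi>) (S \<Otimes>\<^sub>M borel) (Pair \<xi>))"
proof -
  interpret M: prob_space M by fact
  define \<nu> where "\<nu> = distr M S X"
  interpret \<nu>: prob_space \<nu> unfolding \<nu>_def by (rule M.prob_space_distr) fact
  have sets\<nu>[simp, measurable_cong]: "sets \<nu> = sets S" by (simp add: \<nu>_def)
  have [simp]: "space \<nu> = space S" by (simp add: \<nu>_def)
  have "0 \<le> K" using M.not_empty bound by fastforce
  define E where "E A t = {\<omega> \<in> space M. X \<omega> \<in> A \<and> Y \<omega> \<le> t}" for A t
  have E[measurable]: "E A t \<in> sets M" if "A \<in> sets S" for A t
    unfolding E_def using that by measurable
  \<comment> \<open>This measure gives \<open>A\<close> the mass of \<open>E A q\<close>; its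
    density with respect to \<open>\<nu>\<close> is the conditional distribution function at
    \<open>q\<close>.\<close>
  define \<nu>q where "\<nu>q q = distr (density M (indicator {\<omega> \<in> space M. Y \<omega> \<le> q})) S X" for q
  have \<nu>q: "emeasure (\<nu>q q) A = emeasure M (E A q)" if [measurable]: "A \<in> sets S" for q A
  proof -
    have "emeasure (\<nu>q q) A = emeasure (density M (indicator {\<omega> \<in> space M. Y \<omega> \<le> q})) (X -` A \<inter> space M)"
      unfolding \<nu>q_def by (subst emeasure_distr) auto
    also have "\<dots> = (\<integral>\<^sup>+\<omega>. indicator {\<omega> \<in> space M. Y \<omega> \<le> q} \<omega> * indicator (X -` A \<inter> space M) \<omega> \<partial>M)"
      by (subst emeasure_density) auto
    also have "\<dots> = (\<integral>\<^sup>+\<omega>. indicator (E A q) \<omega> \<partial>M)"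
      by (intro nn_integral_cong) (auto simp: E_def indicator_def)
    finally show ?thesis by simp
  qed
  have sets\<nu>q: "sets (\<nu>q q) = sets S" for q by (simp add: \<nu>q_def)
  have space\<nu>q: "space (\<nu>q q) = space S" for q by (simp add: \<nu>q_def)
  have fin\<nu>q: "finite_measure (\<nu>q q)" for q
    by (rule finite_measureI) (simp add: space\<nu>q \<nu>q)
  have le\<nu>: "emeasure (\<nu>q q) A \<le> emeasure \<nu> A" if [measurable]: "A \<in> sets S" for q A
    unfolding \<nu>q[OF that] \<nu>_def
    by (subst emeasure_distr) (auto intro!: emeasure_mono simp: E_def)
  have ac: "absolutely_continuous \<nu> (\<nu>q q)" for q
    using le\<nu>[of _ q] sets\<nu>q[of q] unfolding absolutely_continuous_def null_sets_def by fastforce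
  define r where "r q = RN_deriv \<nu> (\<nu>q (real_of_rat q))" for q :: rat
  have r[measurable]: "r q \<in> borel_measurable S" for q
    using borel_measurable_RN_deriv[of \<nu> "\<nu>q (real_of_rat q)"] by (simp add: r_def)
  have dens: "density \<nu> (r q) = \<nu>q (real_of_rat q)" for q
    unfolding r_def by (rule \<nu>.density_RN_deriv[OF ac]) (simp add: sets\<nu>q)
  have AE_mono: "AE \<xi> in \<nu>. r p \<xi> \<le> r q \<xi>" if "p \<le> q" for p q
    unfolding r_def
    by (rule RN_deriv_mono[OF \<nu>.finite_measure_axioms ac _ _ fin\<nu>q fin\<nu>q])
       (use that in \<open>auto simp: sets\<nu>q \<nu>q E_def of_rat_less_eq intro!: emeasure_mono intro: order_trans\<close>)
  have AE_one: "AE \<xi> in \<nu>. r q \<xi> = 1" if "K \<le> real_of_rat q" for q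
  proof -
    have "density \<nu> (\<lambda>_. 1) = \<nu>q (real_of_rat q)"
    proof (rule measure_eqI)
      fix A assume "A \<in> sets (density \<nu> (\<lambda>_. 1))"
      then have [measurable]: "A \<in> sets S" by simp
      have "E A (real_of_rat q) = X -` A \<inter> space M" using bound that by (force simp: E_def)
      then show "emeasure (density \<nu> (\<lambda>_. 1)) A = emeasure (\<nu>q (real_of_rat q)) A"
        by (simp add: \<nu>q density_1 \<nu>_def emeasure_distr)
    qed (simp add: sets\<nu>q)
    from \<nu>.RN_deriv_unique[OF _ this] show ?thesis unfolding r_def by auto
  qed
  have AE_zero: "AE \<xi> in \<nu>. r q \<xi> = 0" if "real_of_rat q < - K" for q
  proof -
    have "density \<nu> (\<lambda>_. 0) = \<nu>q (real_of_rat q)"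
    proof (rule measure_eqI)
      fix A assume "A \<in> sets (density \<nu> (\<lambda>_. 0))"
      then have [measurable]: "A \<in> sets S" by simp
      have "E A (real_of_rat q) = {}" using bound that by (force simp: E_def)
      then show "emeasure (density \<nu> (\<lambda>_. 0)) A = emeasure (\<nu>q (real_of_rat q)) A"
        by (simp add: \<nu>q emeasure_density)
    qed (simp add: sets\<nu>q)
    from \<nu>.RN_deriv_unique[OF _ this] show ?thesis unfolding r_def by auto
  qed
  \<comment> \<open>Restricting to rational thresholds leaves countably many conditions, each
    holding almost everywhere, so they hold simultaneously almost everywhere.\<close>
  define good where "good \<xi> \<longleftrightarrow> (\<forall>p q. p \<le> q \<longrightarrow> r p \<xi> \<le> r q \<xi>) \<and>
      (\<forall>q. K \<le> real_of_rat q \<longrightarrow> r q \<xi> = 1) \<and> (\<forall>q. real_of_rat q < - K \<longrightarrow> r q \<xi> = 0)" for \<xi>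
  have [measurable]: "Measurable.pred S good"
    unfolding good_def by measurable
  have AE_good: "AE \<xi> in \<nu>. good \<xi>"
    unfolding good_def using AE_mono AE_one AE_zero
    by (auto simp: AE_all_countable AE_conj_iff simp del: AE_impI intro!: AE_impI)
  \<comment> \<open>Off the good set the values are those of the distribution function of the point
    mass at \<open>K\<close>, so that a probability measure arises for every
    \<open>\<xi>\<close>.\<close>
  define rr where "rr q \<xi> = (if good \<xi> then enn2real (r q \<xi>) else if K \<le> real_of_rat q then 1 else 0)" for q \<xi>
  have [measurable]: "rr q \<in> borel_measurable S" for q
    unfolding rr_def by measurable
  have le1: "r q \<xi> \<le> 1" if "good \<xi>" for q \<xi>
  proof -
    obtain n :: nat where "max K (real_of_rat q) \<le> n" using real_arch_simple by blast
    then have "q \<le> of_nat n" "K \<le> real_of_rat (of_nat n)"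
      by (auto simp flip: of_rat_less_eq[where 'a=real])
    then show ?thesis using that unfolding good_def by metis
  qed
  have rr_eq: "ennreal (rr q \<xi>) = r q \<xi>" if "good \<xi>" for q \<xi>
    using le1[OF that, of q] that by (simp add: rr_def top.not_eq_extremum[symmetric]) (metis ennreal_one_less_top ennreal_enn2real le_less_trans)
  have rr_mono: "rr p \<xi> \<le> rr q \<xi>" if "p \<le> q" for p q \<xi>
  proof (cases "good \<xi>")
    case True
    then have "r p \<xi> \<le> r q \<xi>" "r q \<xi> < top"
      using that le1[OF True, of q] by (auto simp: good_def intro: le_less_trans)
    then show ?thesis using True by (simp add: rr_def enn2real_mono)
  next
    case False
    then show ?thesis using that of_rat_less_eq[of p q, where 'a=real] by (auto simp: rr_def)
  qed
  have rr_one: "rr q \<xi> = 1" if "K \<le> real_of_rat q" for q \<xi>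
    using that by (auto simp: rr_def good_def)
  have rr_zero: "rr q \<xi> = 0" if "real_of_rat q < - K" for q \<xi>
    using that \<open>0 \<le> K\<close> by (auto simp: rr_def good_def)
  have rr_nonneg: "0 \<le> rr q \<xi>" for q \<xi> by (simp add: rr_def)
  \<comment> \<open>Taking the infimum over rationals strictly above \<open>t\<close> builds in
    right continuity.\<close>
  define F where "F \<xi> t = (INF q\<in>{q. t < real_of_rat q}. rr q \<xi>)" for \<xi> t
  have ne: "{q. t < real_of_rat q} \<noteq> {}" for t :: real
    using of_rat_dense[of t "t + 1"] by auto
  have bdd: "bdd_below ((\<lambda>q. rr q \<xi>) ` B)" for \<xi> B
    by (rule bdd_belowI[of _ 0]) (auto simp: rr_nonneg)
  have F_le: "F \<xi> t \<le> rr q \<xi>" if "t < real_of_rat q" for \<xi> t q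
    unfolding F_def using that by (intro cINF_lower bdd) auto
  have F_ge: "b \<le> F \<xi> t" if "\<And>q. t < real_of_rat q \<Longrightarrow> b \<le> rr q \<xi>" for b \<xi> t
    unfolding F_def using that by (intro cINF_greatest ne) auto
  have F_less: "\<exists>q. t < real_of_rat q \<and> rr q \<xi> < b" if "F \<xi> t < b" for b \<xi> t
    using that F_ge[of t b \<xi>] by (meson not_le)
  have F_mono: "F \<xi> s \<le> F \<xi> t" if "s \<le> t" for \<xi> s t
    using that by (intro F_ge F_le) auto
  have F_one: "F \<xi> t = 1" if "K \<le> t" for \<xi> t
  proof (rule antisym)
    obtain q where "t < real_of_rat q" using ne[of t] by auto
    then show "F \<xi> t \<le> 1" using F_le[of t q \<xi>] rr_one[of q \<xi>] that by simp
    show "1 \<le> F \<xi> t" using that by (intro F_ge) (simp add: rr_one)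
  qed
  have F_zero: "F \<xi> t = 0" if "t < - K" for \<xi> t
  proof (rule antisym)
    have "\<exists>q. t < real_of_rat q \<and> real_of_rat q < - K" using of_rat_dense[OF that] .
    then obtain q where "t < real_of_rat q" "real_of_rat q < - K" by auto
    then show "F \<xi> t \<le> 0" using F_le[of t q \<xi>] rr_zero[of q \<xi>] by simp
    show "0 \<le> F \<xi> t" by (intro F_ge rr_nonneg)
  qed
  have F_right: "continuous (at_right a) (F \<xi>)" for \<xi> a
    unfolding continuous_within
  proof (rule order_tendstoI)
    fix b assume "b < F \<xi> a"
    then show "\<forall>\<^sub>F t in at_right a. b < F \<xi> t"
      unfolding eventually_at_right_field using F_mono[of a _ \<xi>]
      by (meson less_add_one less_imp_le less_le_trans)
  next
    fix b assume "F \<xi> a < b"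
    then obtain q where "a < real_of_rat q" "rr q \<xi> < b" using F_less by blast
    then show "\<forall>\<^sub>F t in at_right a. F \<xi> t < b"
      unfolding eventually_at_right_field using F_le[of _ q \<xi>] by (meson le_less_trans)
  qed
  have F_bot: "(F \<xi> \<longlongrightarrow> 0) at_bot" for \<xi>
    by (rule tendsto_eventually, unfold eventually_at_bot_dense) (metis F_zero)
  have F_top: "(F \<xi> \<longlongrightarrow> 1) at_top" for \<xi>
    by (rule tendsto_eventually, unfold eventually_at_top_linorder) (metis F_one)
  have F_meas[measurable]: "(\<lambda>\<xi>. F \<xi> t) \<in> borel_measurable S" for t
    unfolding F_def by (rule borel_measurable_cINF) (auto simp: bdd)
  define \<theta> where "\<theta> \<xi> = interval_measure (F \<xi>)" for \<xi>
  have \<theta>_prob: "prob_space (\<theta> \<xi>)" for \<xi>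
    unfolding \<theta>_def using real_distribution_interval_measure[of "F \<xi>"] F_mono F_right F_bot F_top
    by (auto simp: real_distribution_def)
  have \<theta>_sets[measurable_cong]: "sets (\<theta> \<xi>) = sets borel" for \<xi>
    by (simp add: \<theta>_def)
  have \<theta>_cdf: "emeasure (\<theta> \<xi>) {..t} = F \<xi> t" for \<xi> t
    unfolding \<theta>_def by (rule emeasure_interval_measure_Iic) (use F_mono F_right F_bot in auto)
  have \<theta>[measurable]: "\<theta> \<in> S \<rightarrow>\<^sub>M prob_algebra borel"
  proof (rule measurable_prob_algebra_generated)
    show "sets borel = sigma_sets UNIV (range (\<lambda>a::real. {..a}))"
      by (subst borel_eq_atMost) simp
    show "Int_stable (range (\<lambda>a::real. {..a}))"
      by (auto simp: Int_stable_def intro: range_eqI[of _ _ "min _ _"])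
    show "(\<lambda>a. emeasure (\<theta> a) A) \<in> borel_measurable S" if "A \<in> range (\<lambda>a::real. {..a})" for A
      using that by (auto simp: \<theta>_cdf)
  qed (auto simp: \<theta>_prob \<theta>_sets)
  have cdf_integral: "(\<integral>\<^sup>+\<xi>. ennreal (F \<xi> t) * indicator A \<xi> \<partial>\<nu>) = emeasure M (E A t)"
    if A[measurable]: "A \<in> sets S" for A t
  proof -
    \<comment> \<open>The identity holds at rational thresholds by construction of the densities. It
      passes to \<open>t\<close> along rationals converging from the right, by dominated convergence
      on both sides.\<close>
    have "\<exists>q. t < real_of_rat q \<and> real_of_rat q < t + 1 / Suc n" for n
      using of_rat_dense[of t "t + 1 / Suc n"] by auto
    then obtain p where p: "\<And>n. t < real_of_rat (p n)" "\<And>n. real_of_rat (p n) < t + 1 / Suc n"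
      by metis
    have p_lim: "(\<lambda>n. real_of_rat (p n)) \<longlonglongrightarrow> t"
    proof (rule tendsto_sandwich[OF _ _ tendsto_const])
      show "(\<lambda>n. t + 1 / Suc n) \<longlonglongrightarrow> t"
        using tendsto_add[OF tendsto_const LIMSEQ_inverse_real_of_nat, of t] by (simp add: inverse_eq_divide)
    qed (use p in \<open>auto intro!: always_eventually simp: less_imp_le\<close>)
    have "(\<lambda>n. rr (p n) \<xi>) \<longlonglongrightarrow> F \<xi> t" for \<xi>
    proof (rule order_tendstoI)
      fix b assume "b < F \<xi> t"
      then show "\<forall>\<^sub>F n in sequentially. b < rr (p n) \<xi>" by (intro always_eventually allI less_le_trans[OF _ F_le[OF p(1)]])
    next
      fix b assume "F \<xi> t < b"
      then obtain q where q: "t < real_of_rat q" "rr q \<xi> < b" using F_less by blast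
      have "\<forall>\<^sub>F n in sequentially. real_of_rat (p n) < real_of_rat q"
        using p_lim q(1) by (rule order_tendstoD)
      then show "\<forall>\<^sub>F n in sequentially. rr (p n) \<xi> < b"
        by eventually_elim (metis q(2) rr_mono of_rat_less less_imp_le le_less_trans)
    qed
    then have "(\<lambda>n. \<integral>\<^sup>+\<xi>. ennreal (rr (p n) \<xi>) * indicator A \<xi> \<partial>\<nu>)
        \<longlonglongrightarrow> (\<integral>\<^sup>+\<xi>. ennreal (F \<xi> t) * indicator A \<xi> \<partial>\<nu>)"
    proof (intro nn_integral_dominated_convergence[where w="\<lambda>_. 1"])
      have "rr q \<xi> \<le> 1" for q \<xi>
        using le1[of \<xi> q] by (auto simp: rr_def enn2real_leI)
      then show "AE \<xi> in \<nu>. ennreal (rr (p n) \<xi>) * indicator A \<xi> \<le> 1" for n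
        by (auto simp: indicator_def)
      assume "\<And>\<xi>. (\<lambda>n. rr (p n) \<xi>) \<longlonglongrightarrow> F \<xi> t"
      then have "(\<lambda>n. ennreal (rr (p n) \<xi>)) \<longlonglongrightarrow> ennreal (F \<xi> t)" for \<xi> by (intro tendsto_ennrealI)
      then show "AE \<xi> in \<nu>. (\<lambda>n. ennreal (rr (p n) \<xi>) * indicator A \<xi>) \<longlonglongrightarrow> ennreal (F \<xi> t) * indicator A \<xi>"
        by (auto simp: indicator_def)
    qed (use \<nu>.emeasure_space_1 in auto)
    moreover have "(\<integral>\<^sup>+\<xi>. ennreal (rr q \<xi>) * indicator A \<xi> \<partial>\<nu>) = emeasure M (E A (real_of_rat q))" for q
    proof -
      have "(\<integral>\<^sup>+\<xi>. ennreal (rr q \<xi>) * indicator A \<xi> \<partial>\<nu>) = (\<integral>\<^sup>+\<xi>. r q \<xi> * indicator A \<xi> \<partial>\<nu>)"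
        using AE_good by (intro nn_integral_cong_AE) (auto simp: rr_eq)
      also have "\<dots> = emeasure (density \<nu> (r q)) A" by (simp add: emeasure_density)
      finally show ?thesis by (simp add: dens \<nu>q)
    qed
    moreover have "(\<lambda>n. emeasure M (E A (real_of_rat (p n)))) \<longlonglongrightarrow> emeasure M (E A t)"
    proof -
      have "(\<lambda>n. \<integral>\<^sup>+\<omega>. indicator (E A (real_of_rat (p n))) \<omega> \<partial>M) \<longlonglongrightarrow> (\<integral>\<^sup>+\<omega>. indicator (E A t) \<omega> \<partial>M)"
      proof (intro nn_integral_dominated_convergence[where w="\<lambda>_. 1"] AE_I2)
        fix \<omega> assume "\<omega> \<in> space M"
        show "(\<lambda>n. indicator (E A (real_of_rat (p n))) \<omega> :: ennreal) \<longlonglongrightarrow> indicator (E A t) \<omega>"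
        proof (cases "Y \<omega> \<le> t")
          case True
          then have "Y \<omega> \<le> real_of_rat (p n)" for n using p(1)[of n] by simp
          then show ?thesis using True by (simp add: E_def indicator_def)
        next
          case False
          then have "\<forall>\<^sub>F n in sequentially. real_of_rat (p n) < Y \<omega>"
            using p_lim by (intro order_tendstoD) auto
          then have "\<forall>\<^sub>F n in sequentially. indicator (E A (real_of_rat (p n))) \<omega> = (indicator (E A t) \<omega> :: ennreal)"
            by eventually_elim (use False in \<open>auto simp: E_def indicator_def\<close>)
          then show ?thesis by (rule tendsto_eventually)
        qed
      qed (auto simp: M.emeasure_space_1 indicator_def)
      then show ?thesis by simp
    qed
    ultimately show ?thesis using LIMSEQ_unique by auto
  qed
  let ?J = "\<nu> \<bind> (\<lambda>\<xi>. distr (\<theta> \<xi>) (S \<Otimes>\<^sub>M borel) (Pair \<xi>))"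
  have kern: "(\<lambda>\<xi>. distr (\<theta> \<xi>) (S \<Otimes>\<^sub>M borel) (Pair \<xi>)) \<in> S \<rightarrow>\<^sub>M prob_algebra (S \<Otimes>\<^sub>M borel)"
    by (rule measurable_distr_prob_space2[OF \<theta>]) measurable
  have "\<nu> \<in> space (prob_algebra S)" by (simp add: space_prob_algebra \<nu>.prob_space_axioms)
  note bind = emeasure_bind_prob_algebra[OF this kern]
  have "distr M (S \<Otimes>\<^sub>M borel) (\<lambda>\<omega>. (X \<omega>, Y \<omega>)) = ?J"
  proof (rule measure_eqI_generator_eq)
    let ?E = "{A \<times> B | A B. A \<in> sets S \<and> B \<in> range (\<lambda>a::real. {..a})}"
    have gen: "sets (S \<Otimes>\<^sub>M (borel :: real measure)) = sigma_sets (space S \<times> UNIV) ?E"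
    proof -
      have sets_borel: "sets (borel :: real measure) = sigma_sets UNIV (range (\<lambda>a::real. {..a}))"
        by (subst borel_eq_atMost) simp
      have cover: "(\<Union>n::nat. {..real n}) = UNIV" by (auto intro: real_arch_simple)
      have "sets (S \<Otimes>\<^sub>M borel) = sets (sigma (space S \<times> space (borel :: real measure)) ?E)"
        by (rule sets_pair_eq[where Ca="{space S}" and Cb="range (\<lambda>n::nat. {..real n})"])
           (auto simp: sets.sigma_sets_eq sets_borel cover dest: sets.sets_into_space)
      also have "\<dots> = sigma_sets (space S \<times> UNIV) ?E"
        by (subst sets_measure_of) (auto dest: sets.sets_into_space)
      finally show ?thesis .
    qed
    show "Int_stable ?E"
    proof (rule Int_stableI)
      fix P Q assume "P \<in> ?E" "Q \<in> ?E"
      then obtain A B a b where "A \<in> sets S" "B \<in> sets S" "P = A \<times> {..a}" "Q = B \<times> {..b}" by auto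
      then have "P \<inter> Q = (A \<inter> B) \<times> {..min a b}" "A \<inter> B \<in> sets S" by auto
      then show "P \<inter> Q \<in> ?E" by blast
    qed
    show "?E \<subseteq> Pow (space S \<times> UNIV)" by (auto dest: sets.sets_into_space)
    show "sets (distr M (S \<Otimes>\<^sub>M borel) (\<lambda>\<omega>. (X \<omega>, Y \<omega>))) = sigma_sets (space S \<times> UNIV) ?E"
      by (simp add: gen)
    show "sets ?J = sigma_sets (space S \<times> UNIV) ?E"
      using \<nu>.not_empty by (subst sets_bind[where N="S \<Otimes>\<^sub>M borel"]) (auto simp flip: gen)
    show "range (\<lambda>n::nat. space S \<times> {..real n}) \<subseteq> ?E" by auto
    show "(\<Union>n::nat. space S \<times> {..real n}) = space S \<times> UNIV" by (auto intro: real_arch_simple)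
    show "emeasure (distr M (S \<Otimes>\<^sub>M borel) (\<lambda>\<omega>. (X \<omega>, Y \<omega>))) (space S \<times> {..real n}) \<noteq> \<infinity>" for n
      by (subst emeasure_distr) auto
    fix P assume "P \<in> ?E"
    then obtain A t where A[measurable]: "A \<in> sets S" and P: "P = A \<times> {..t}" by auto
    have "emeasure (distr M (S \<Otimes>\<^sub>M borel) (\<lambda>\<omega>. (X \<omega>, Y \<omega>))) P = emeasure M (E A t)"
      unfolding P by (subst emeasure_distr) (auto simp: E_def intro!: arg_cong2[where f=emeasure])
    also have "\<dots> = (\<integral>\<^sup>+\<xi>. emeasure (distr (\<theta> \<xi>) (S \<Otimes>\<^sub>M borel) (Pair \<xi>)) P \<partial>\<nu>)"
      unfolding cdf_integral[OF A, symmetric]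
    proof (intro nn_integral_cong)
      fix \<xi> assume "\<xi> \<in> space \<nu>"
      then have \<xi>: "\<xi> \<in> space S" by simp
      have "emeasure (distr (\<theta> \<xi>) (S \<Otimes>\<^sub>M borel) (Pair \<xi>)) P = emeasure (\<theta> \<xi>) (Pair \<xi> -` P \<inter> space (\<theta> \<xi>))"
        using \<xi> by (intro emeasure_distr) (auto simp: P)
      also have "Pair \<xi> -` P \<inter> space (\<theta> \<xi>) = (if \<xi> \<in> A then {..t} else {})"
        by (auto simp: P \<theta>_def)
      finally show "ennreal (F \<xi> t) * indicator A \<xi> = emeasure (distr (\<theta> \<xi>) (S \<Otimes>\<^sub>M borel) (Pair \<xi>)) P"
        by (simp add: \<theta>_cdf)
    qed
    also have "\<dots> = emeasure ?J P"
      by (rule bind[symmetric]) (auto simp: P)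
    finally show "emeasure (distr M (S \<Otimes>\<^sub>M borel) (\<lambda>\<omega>. (X \<omega>, Y \<omega>))) P = emeasure ?J P" .
  qed
  with \<theta> show ?thesis unfolding \<nu>_def by (rule that)
qed

section \<open>Borel structure of the skew space and its disintegrations\<close>

text \<open>\<open>Arg\<close> is continuous off the nonpositive real axis, and on that axis it
  takes only the values \<open>0\<close> and \<open>pi\<close>.\<close>

lemma borel_measurable_Arg [measurable]: "Arg \<in> borel_measurable borel"
proof -
  let ?N = "\<real>\<^sub>\<le>\<^sub>0 :: complex set"
  have "Arg z = (if z \<in> ?N then if z = 0 then 0 else pi else Arg z)" for z
  proof (cases "z \<in> ?N")
    case True
    then have z: "Re z \<le> 0" "Im z = 0" by (auto simp: complex_nonpos_Reals_iff)
    have "Re z < 0" if "z \<noteq> 0" using that z complex_eqI[of z 0] by fastforce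
    with z True show ?thesis using Arg_eq_pi[of z] by (auto simp: Arg_zero)
  qed simp
  then have eq: "Arg = (\<lambda>z. if z \<in> ?N then if z = 0 then 0 else pi else Arg z)" by (rule ext)
  have N: "{z \<in> space borel. z \<in> ?N} \<in> sets borel"
    using borel_closed[OF closed_nonpos_Reals_complex] by simp
  have const: "(\<lambda>z::complex. if z = 0 then 0 else pi) \<in> borel_measurable borel" by measurable
  have "{z. z \<notin> ?N} = - ?N" by auto
  then have "Arg \<in> borel_measurable (restrict_space borel {z. z \<notin> ?N})"
    using borel_measurable_continuous_on_restrict[OF continuous_on_Arg] by simp
  then have "(\<lambda>z. if z \<in> ?N then if z = 0 then 0 else pi else Arg z) \<in> borel_measurable borel"
    using measurable_restrict_space1[OF const] by (subst measurable_If_restrict_space_iff[OF N]) simp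
  then show ?thesis by (subst eq)
qed

lemma space_skew_borel: "space (skew_borel k) = skew_space k"
  by (simp add: space_restrict_space)

lemma shift_space_closed: "closed (shift_space k)"
proof -
  have "closed {\<xi> :: int \<Rightarrow> nat. \<xi> j \<in> {1..k}}" for j
    using closed_vimage[OF _ continuous_on_product_coordinates, of "{1..k}" j]
    by (simp add: vimage_def)
  then show ?thesis unfolding shift_space_def by (rule closed_Collect_all)
qed

lemma skew_space_closed: "closed (skew_space k)"
  unfolding skew_space_def by (intro closed_Times shift_space_closed closed_sphere)

lemma sets_skew_borel: "A \<in> sets (skew_borel k) \<longleftrightarrow> A \<in> sets borel \<and> A \<subseteq> skew_space k"
  using borel_closed[OF skew_space_closed[of k]] by (subst sets_restrict_space_iff) auto

lemma closed_singleton_sequence: "closed {\<xi> :: int \<Rightarrow> nat}"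
proof -
  have "closed {\<eta> :: int \<Rightarrow> nat. \<eta> j \<in> {\<xi> j}}" for j
    using closed_vimage[OF _ continuous_on_product_coordinates, of "{\<xi> j}" j]
    by (simp add: vimage_def)
  then have "closed {\<eta>. \<forall>j. \<eta> j \<in> {\<xi> j}}" by (rule closed_Collect_all)
  moreover have "{\<eta>. \<forall>j. \<eta> j \<in> {\<xi> j}} = {\<xi>}" by auto
  ultimately show ?thesis by simp
qed

lemma singleton_skew_borel: "z \<in> skew_space k \<Longrightarrow> {z} \<in> sets (skew_borel k)"
  using closed_Times[OF closed_singleton_sequence closed_singleton, of "fst z" "snd z"]
  by (simp add: sets_skew_borel borel_closed)

lemma fiber_skew_borel: "\<xi> \<in> shift_space k \<Longrightarrow> {\<xi>} \<times> circle \<in> sets (skew_borel k)"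
  unfolding sets_skew_borel by (auto simp: skew_space_def intro!: borel_closed closed_Times closed_singleton_sequence)

lemma measurable_fst_skew: "fst \<in> skew_borel k \<rightarrow>\<^sub>M restrict_space borel (shift_space k)"
proof (rule measurable_restrict_space2)
  show "fst \<in> skew_borel k \<rightarrow>\<^sub>M (borel :: (int \<Rightarrow> nat) measure)"
    by (intro measurable_restrict_space1) (simp add: borel_prod[symmetric])
qed (simp add: space_skew_borel Pi_def, auto simp: skew_space_def)

text \<open>The angle \<open>Arg (snd z)\<close> is a bounded real variable, so it has a conditional
  distribution given the base point. Pushing this forward by \<open>\<Phi>\<close> gives the fiber
  measures; the first coordinate is kept fixed, so each has full mass on its own fiber.\<close>

lemma fiber_disintegration_exists:
  assumes "prob_space \<mu>" and sets: "sets \<mu> = sets (skew_borel k)"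
  obtains \<kappa> where "fiber_disintegration k \<mu> \<kappa>"
proof -
  define S where "S = restrict_space (borel :: (int \<Rightarrow> nat) measure) (shift_space k)"
  have spaceS: "space S = shift_space k" by (simp add: S_def space_restrict_space)
  have space\<mu>: "space \<mu> = skew_space k" using sets_eq_imp_space_eq[OF sets] by (simp add: space_skew_borel)
  have X: "fst \<in> \<mu> \<rightarrow>\<^sub>M S"
    using measurable_fst_skew unfolding S_def measurable_cong_sets[OF sets refl] .
  have Y: "(\<lambda>z. Arg (snd z)) \<in> borel_measurable \<mu>"
    unfolding measurable_cong_sets[OF sets refl]
    by (intro measurable_restrict_space1) (simp add: borel_prod[symmetric])
  have Arg_le: "\<bar>Arg (snd z)\<bar> \<le> pi" if "z \<in> space \<mu>" for z
    using Arg_bounded[of "snd z"] by linarith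
  obtain \<theta> where \<theta>[measurable]: "\<theta> \<in> S \<rightarrow>\<^sub>M prob_algebra borel"
    and joint: "distr \<mu> (S \<Otimes>\<^sub>M borel) (\<lambda>z. (fst z, Arg (snd z))) =
         distr \<mu> S fst \<bind> (\<lambda>\<xi>. distr (\<theta> \<xi>) (S \<Otimes>\<^sub>M borel) (Pair \<xi>))"
    by (rule conditional_distribution_exists[OF assms(1) X Y Arg_le]) (assumption, rule that)
  define \<Phi> where "\<Phi> = (\<lambda>(\<xi> :: int \<Rightarrow> nat, t). (\<xi>, cis t))"
  have \<Phi>[measurable]: "\<Phi> \<in> S \<Otimes>\<^sub>M borel \<rightarrow>\<^sub>M skew_borel k"
  proof (rule measurable_restrict_space2)
    have "cis \<in> borel_measurable borel" by (intro borel_measurable_continuous_onI continuous_intros)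
    moreover have "(\<lambda>\<xi>. \<xi>) \<in> S \<rightarrow>\<^sub>M borel" unfolding S_def by (intro measurable_restrict_space1) simp
    ultimately show "\<Phi> \<in> S \<Otimes>\<^sub>M borel \<rightarrow>\<^sub>M borel"
      unfolding \<Phi>_def borel_prod[symmetric] by measurable
    show "\<Phi> \<in> space (S \<Otimes>\<^sub>M borel) \<rightarrow> skew_space k"
      by (auto simp: space_pair_measure spaceS \<Phi>_def skew_space_def)
  qed
  have Pair[measurable]: "Pair \<xi> \<in> borel \<rightarrow>\<^sub>M S \<Otimes>\<^sub>M borel" if "\<xi> \<in> space S" for \<xi>
    using that by simp
  have \<theta>_sets: "sets (\<theta> \<xi>) = sets borel" "prob_space (\<theta> \<xi>)" if "\<xi> \<in> space S" for \<xi>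
    using measurable_space[OF \<theta> that] by (auto simp: space_prob_algebra)
  define J where "J \<xi> = distr (\<theta> \<xi>) (S \<Otimes>\<^sub>M borel) (Pair \<xi>)" for \<xi>
  have J: "J \<in> S \<rightarrow>\<^sub>M prob_algebra (S \<Otimes>\<^sub>M borel)"
    unfolding J_def by (rule measurable_distr_prob_space2[OF \<theta>]) measurable
  define \<kappa> where "\<kappa> \<xi> = distr (J \<xi>) (skew_borel k) \<Phi>" for \<xi>
  have \<kappa>: "\<kappa> \<in> S \<rightarrow>\<^sub>M prob_algebra (skew_borel k)"
    unfolding \<kappa>_def using measurable_compose[OF J measurable_distr_prob_space[OF \<Phi>]] by simp
  have base: "base_measure k \<mu> = distr \<mu> S fst" by (simp add: base_measure_def S_def)
  have sets_base: "sets (base_measure k \<mu>) = sets S" by (simp add: base)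
  have Jset: "emeasure (\<kappa> \<xi>) A = emeasure (J \<xi>) (\<Phi> -` A \<inter> space (S \<Otimes>\<^sub>M borel))"
    if "A \<in> sets (skew_borel k)" for A \<xi>
  proof -
    have sets_J: "sets (J \<xi>) = sets (S \<Otimes>\<^sub>M borel)" by (simp add: J_def)
    have "\<Phi> \<in> J \<xi> \<rightarrow>\<^sub>M skew_borel k"
      using \<Phi> unfolding measurable_cong_sets[OF sets_J refl] .
    from emeasure_distr[OF this that] show ?thesis
      unfolding \<kappa>_def sets_eq_imp_space_eq[OF sets_J] .
  qed
  have "emeasure (\<kappa> \<xi>) ({\<xi>} \<times> circle) = 1" if "\<xi> \<in> shift_space k" for \<xi>
  proof -
    have \<xi>: "\<xi> \<in> space S" using that spaceS by simp
    interpret prob_space "\<theta> \<xi>" by (rule \<theta>_sets[OF \<xi>])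
    have fib: "\<Phi> -` ({\<xi>} \<times> circle) \<inter> space (S \<Otimes>\<^sub>M borel) \<in> sets (S \<Otimes>\<^sub>M borel)"
      using fiber_skew_borel[OF that] by (rule measurable_sets[OF \<Phi>])
    have "Pair \<xi> \<in> \<theta> \<xi> \<rightarrow>\<^sub>M S \<Otimes>\<^sub>M borel"
      using Pair[OF \<xi>] unfolding measurable_cong_sets[OF \<theta>_sets(1)[OF \<xi>] refl] .
    note distr = emeasure_distr[OF this fib]
    have "emeasure (\<kappa> \<xi>) ({\<xi>} \<times> circle) =
        emeasure (\<theta> \<xi>) (Pair \<xi> -` (\<Phi> -` ({\<xi>} \<times> circle) \<inter> space (S \<Otimes>\<^sub>M borel)) \<inter> space (\<theta> \<xi>))"
      unfolding Jset[OF fiber_skew_borel[OF that]] J_def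
      by (rule distr)
    also have "Pair \<xi> -` (\<Phi> -` ({\<xi>} \<times> circle) \<inter> space (S \<Otimes>\<^sub>M borel)) \<inter> space (\<theta> \<xi>) = space (\<theta> \<xi>)"
      using \<xi> by (auto simp: \<Phi>_def space_pair_measure)
    finally show ?thesis by (simp add: emeasure_space_1)
  qed
  moreover have "emeasure \<mu> A = (\<integral>\<^sup>+ \<xi>. emeasure (\<kappa> \<xi>) A \<partial>base_measure k \<mu>)"
    if A: "A \<in> sets (skew_borel k)" for A
  proof -
    let ?B = "\<Phi> -` A \<inter> space (S \<Otimes>\<^sub>M borel)"
    have B: "?B \<in> sets (S \<Otimes>\<^sub>M borel)" using A by (rule measurable_sets[OF \<Phi>])
    have XY: "(\<lambda>z. (fst z, Arg (snd z))) \<in> \<mu> \<rightarrow>\<^sub>M S \<Otimes>\<^sub>M borel"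
      by (intro measurable_Pair X Y)
    have "(\<lambda>z. (fst z, Arg (snd z))) -` ?B \<inter> space \<mu> = A"
    proof -
      have "A \<subseteq> skew_space k" using A sets_skew_borel by blast
      then show ?thesis
        by (auto simp: \<Phi>_def space_pair_measure spaceS space\<mu> skew_space_def cis_Arg_circle subset_iff)
    qed
    then have "emeasure \<mu> A = emeasure (distr \<mu> (S \<Otimes>\<^sub>M borel) (\<lambda>z. (fst z, Arg (snd z)))) ?B"
      using emeasure_distr[OF XY B] by simp
    also have "\<dots> = (\<integral>\<^sup>+ \<xi>. emeasure (J \<xi>) ?B \<partial>base_measure k \<mu>)"
      unfolding joint base J_def[symmetric]
    proof (rule emeasure_bind_prob_algebra[OF _ J B])
      show "distr \<mu> S fst \<in> space (prob_algebra S)"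
        using prob_space.prob_space_distr[OF assms(1) X] by (simp add: space_prob_algebra)
    qed
    finally show ?thesis by (simp add: Jset[OF A])
  qed
  moreover have "\<kappa> \<in> base_measure k \<mu> \<rightarrow>\<^sub>M prob_algebra (skew_borel k)"
    unfolding measurable_cong_sets[OF sets_base refl] by (rule \<kappa>)
  ultimately show ?thesis using that unfolding fiber_disintegration_def by blast
qed

text \<open>A null set of \<open>\<mu>\<close> is null for almost every
  \<open>\<kappa> \<xi>\<close>. Together with the full mass on the fiber over \<open>\<xi>\<close>,
  this concentrates \<open>\<kappa> \<xi>\<close> on the countable set
  \<open>{\<xi>} \<times> (C \<xi> \<inter> circle)\<close>.\<close>

lemma atomic_disintegrationI:
  assumes prob: "prob_space \<mu>" and sets: "sets \<mu> = sets (skew_borel k)"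
    and countable: "\<And>\<xi>. countable (C \<xi>)" and AE: "AE z in \<mu>. snd z \<in> C (fst z)"
  shows "atomic_disintegration k \<mu>"
  unfolding atomic_disintegration_def
proof (intro conjI allI impI)
  show "\<exists>\<kappa>. fiber_disintegration k \<mu> \<kappa>"
    using fiber_disintegration_exists[OF prob sets] by blast
next
  fix \<kappa> assume \<kappa>: "fiber_disintegration k \<mu> \<kappa>"
  have space\<mu>: "space \<mu> = skew_space k" using sets_eq_imp_space_eq[OF sets] by (simp add: space_skew_borel)
  \<comment> \<open>The exceptional set may fail to be measurable, so a measurable null set covering
    it is integrated instead.\<close>
  obtain N where N: "N \<in> null_sets \<mu>" "{z \<in> space \<mu>. snd z \<notin> C (fst z)} \<subseteq> N"
    using AE unfolding eventually_ae_filter by auto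
  then have Nset: "N \<in> sets (skew_borel k)" using sets by (auto simp: null_sets_def)
  have kern: "\<kappa> \<in> base_measure k \<mu> \<rightarrow>\<^sub>M prob_algebra (skew_borel k)"
    using \<kappa> by (simp add: fiber_disintegration_def)
  have "(\<integral>\<^sup>+ \<xi>. emeasure (\<kappa> \<xi>) N \<partial>base_measure k \<mu>) = 0"
    using \<kappa> N Nset unfolding fiber_disintegration_def null_sets_def by auto
  moreover have "(\<lambda>\<xi>. emeasure (\<kappa> \<xi>) N) \<in> borel_measurable (base_measure k \<mu>)"
    using measurable_emeasure_kernel[OF measurable_prob_algebraD[OF kern] Nset] .
  ultimately have "AE \<xi> in base_measure k \<mu>. emeasure (\<kappa> \<xi>) N = 0"
    by (simp add: nn_integral_0_iff_AE)
  moreover have "AE \<xi> in base_measure k \<mu>. \<xi> \<in> shift_space k"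
    by (rule AE_I2) (simp add: base_measure_def space_restrict_space)
  ultimately show "AE \<xi> in base_measure k \<mu>. atomic_measure (\<kappa> \<xi>)"
  proof eventually_elim
    fix \<xi> assume null: "emeasure (\<kappa> \<xi>) N = 0" and \<xi>: "\<xi> \<in> shift_space k"
    then have "\<kappa> \<xi> \<in> space (prob_algebra (skew_borel k))"
      using measurable_space[OF kern, of \<xi>] by (simp add: base_measure_def space_restrict_space)
    then have P: "prob_space (\<kappa> \<xi>)" and sets\<kappa>: "sets (\<kappa> \<xi>) = sets (skew_borel k)"
      by (auto simp: space_prob_algebra)
    interpret prob_space "\<kappa> \<xi>" by (rule P)
    have space\<kappa>: "space (\<kappa> \<xi>) = skew_space k" using sets_eq_imp_space_eq[OF sets\<kappa>] by (simp add: space_skew_borel)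
    let ?D = "{\<xi>} \<times> (C \<xi> \<inter> circle)"
    have one: "emeasure (\<kappa> \<xi>) ({\<xi>} \<times> circle) = 1"
      using \<kappa> \<xi> by (simp add: fiber_disintegration_def)
    have fib: "{\<xi>} \<times> circle \<in> sets (\<kappa> \<xi>)" using fiber_skew_borel[OF \<xi>] sets\<kappa> by simp
    have "AE z in \<kappa> \<xi>. z \<notin> N" 
      using null Nset sets\<kappa> by (intro AE_not_in) (auto simp: null_sets_def)
    moreover have "AE z in \<kappa> \<xi>. z \<in> {\<xi>} \<times> circle"
      using one fib by (intro AE_prob_1) (simp add: measure_def)
    ultimately have AE_D: "AE z in \<kappa> \<xi>. z \<in> ?D"
      using AE_space
    proof eventually_elim
      case (elim z)
      then show ?case using N(2) space\<mu> space\<kappa> by (cases z) (auto simp: subset_iff)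
    qed
    have D: "countable ?D" "?D \<subseteq> space (\<kappa> \<xi>)" 
      using countable[of \<xi>] \<xi> by (auto simp: space\<kappa> skew_space_def countable_Int1 intro!: countable_SIGMA)
    have single: "{z} \<in> sets (\<kappa> \<xi>)" if "z \<in> ?D" for z
      using singleton_skew_borel D(2) space\<kappa> that unfolding sets\<kappa> by blast
    have "?D \<in> sets (\<kappa> \<xi>)" using single D(1) by (rule sets.countable)
    then have "emeasure (\<kappa> \<xi>) (space (\<kappa> \<xi>) - ?D) = 0"
      using AE_D by (subst (asm) AE_iff_measurable[OF _ refl]) (auto simp: set_diff_eq)
    moreover have "?D \<noteq> {}"
      using AE_D AE_False by (metis (no_types, lifting) AE_cong empty_iff)
    ultimately show "atomic_measure (\<kappa> \<xi>)"
      using D single by (intro conull_countable_atomic[of ?D]) auto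
  qed
qed

section \<open>Mass of closed sets under weak-star limits\<close>

lemma zero_set_sets:
  fixes \<psi> :: "(int \<Rightarrow> nat) \<times> complex \<Rightarrow> real"
  assumes "continuous_on UNIV \<psi>"
  shows "{z. \<psi> z = 0} \<inter> skew_space k \<in> sets (skew_borel k)"
  using closed_Collect_eq[OF assms continuous_on_const[of UNIV 0]] skew_space_closed
  by (simp add: sets_skew_borel borel_closed closed_Int)

text \<open>This is the portmanteau inequality for a closed set given as the zero set of
  \<open>\<psi>\<close>. The continuous functions \<open>\<phi> j\<close> equal 1 on
  \<open>D\<close>, and they converge pointwise to its indicator as \<open>j\<close> grows.\<close>

lemma weak_star_limit_zero_set:
  fixes \<psi> :: "(int \<Rightarrow> nat) \<times> complex \<Rightarrow> real"
  assumes lim: "weak_star_limit k \<mu>s \<mu>"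
    and prob: "prob_space \<mu>" "\<And>n. prob_space (\<mu>s n)"
    and sets: "sets \<mu> = sets (skew_borel k)" "\<And>n. sets (\<mu>s n) = sets (skew_borel k)"
    and \<psi>: "continuous_on UNIV \<psi>" "\<And>z. 0 \<le> \<psi> z" and D: "D = {z. \<psi> z = 0}"
    and ev: "\<forall>\<^sub>F n in sequentially. c \<le> measure (\<mu>s n) (D \<inter> skew_space k)"
  shows "c \<le> measure \<mu> (D \<inter> skew_space k)"
proof -
  define \<phi> where "\<phi> j z = max 0 (1 - real j * \<psi> z)" for j z
  have cont: "continuous_on UNIV (\<phi> j)" for j
    unfolding \<phi>_def by (intro continuous_intros \<psi>)
  have \<phi>: "0 \<le> \<phi> j z" "\<phi> j z \<le> 1" for j z
    by (auto simp: \<phi>_def \<psi>)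
  have \<phi>D: "\<phi> j z = 1" if "z \<in> D" for j z using that by (simp add: \<phi>_def D)
  have meas: "\<phi> j \<in> borel_measurable M" if "sets M = sets (skew_borel k)" for j M
    unfolding measurable_cong_sets[OF that refl]
    by (intro measurable_restrict_space1 borel_measurable_continuous_onI cont)
  have Dsets: "D \<inter> skew_space k \<in> sets (skew_borel k)"
    unfolding D by (rule zero_set_sets[OF \<psi>(1)])
  have space: "space M = skew_space k" if "sets M = sets (skew_borel k)" for M
    using sets_eq_imp_space_eq[OF that] by (simp add: space_skew_borel)
  have "c \<le> (\<integral>z. \<phi> j z \<partial>\<mu>)" for j
  proof (rule tendsto_lowerbound)
    show "(\<lambda>n. \<integral>z. \<phi> j z \<partial>\<mu>s n) \<longlonglongrightarrow> (\<integral>z. \<phi> j z \<partial>\<mu>)"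
      using lim continuous_on_subset[OF cont] unfolding weak_star_limit_def by blast
    show "\<forall>\<^sub>F n in sequentially. c \<le> (\<integral>z. \<phi> j z \<partial>\<mu>s n)"
      using ev
    proof eventually_elim
      case (elim n)
      interpret prob_space "\<mu>s n" by (rule prob)
      have "measure (\<mu>s n) (D \<inter> skew_space k) = (\<integral>z. indicator (D \<inter> skew_space k) z \<partial>\<mu>s n)"
        using Dsets sets by simp
      also have "\<dots> \<le> (\<integral>z. \<phi> j z \<partial>\<mu>s n)"
      proof (rule integral_mono)
        show "integrable (\<mu>s n) (indicator (D \<inter> skew_space k) :: _ \<Rightarrow> real)"
          using Dsets sets by (simp add: emeasure_finite less_top[symmetric])
        show "integrable (\<mu>s n) (\<phi> j)"
          using meas[OF sets(2)] \<phi> by (intro integrable_const_bound[where B=1]) auto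
      qed (auto simp: indicator_def \<phi> \<phi>D)
      finally show ?case using elim by simp
    qed
  qed simp
  moreover have "(\<lambda>j. \<integral>z. \<phi> j z \<partial>\<mu>) \<longlonglongrightarrow> (\<integral>z. indicator (D \<inter> skew_space k) z \<partial>\<mu>)"
  proof (rule integral_dominated_convergence[where w="\<lambda>_. 1"])
    interpret prob_space \<mu> by (rule prob)
    show "integrable \<mu> (\<lambda>_. 1 :: real)" by simp
    show "AE z in \<mu>. (\<lambda>j. \<phi> j z) \<longlonglongrightarrow> indicator (D \<inter> skew_space k) z"
    proof (rule AE_I2)
      fix z assume z: "z \<in> space \<mu>"
      show "(\<lambda>j. \<phi> j z) \<longlonglongrightarrow> indicator (D \<inter> skew_space k) z"
      proof (cases "z \<in> D")
        case True
        then show ?thesis using z space[OF sets(1)] by (simp add: \<phi>D)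
      next
        case notD: False
        then have pos: "0 < \<psi> z" using \<psi>(2)[of z] by (simp add: D less_le)
        obtain m :: nat where m: "1 / \<psi> z < m" using reals_Archimedean2 by blast
        have "\<phi> j z = 0" if "m \<le> j" for j
        proof -
          have "1 < real m * \<psi> z" using m pos by (simp add: field_simps)
          also have "\<dots> \<le> real j * \<psi> z" using that pos by (intro mult_right_mono) auto
          finally show ?thesis by (simp add: \<phi>_def)
        qed
        then have "\<forall>\<^sub>F j in sequentially. \<phi> j z = 0" by (auto simp: eventually_sequentially)
        then show ?thesis using notD by (simp add: tendsto_eventually)
      qed
    qed
  qed (use meas[OF sets(1)] Dsets sets \<phi> in auto)
  ultimately have "c \<le> (\<integral>z. indicator (D \<inter> skew_space k) z \<partial>\<mu>)"
    by (intro LIMSEQ_le_const) auto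
  then show ?thesis using Dsets sets by simp
qed

section \<open>Words and periodic sequences\<close>

lemma length_concat_replicate: "length (concat (replicate c u)) = c * length u"
  by (induction c) auto

lemma nth_concat_replicate:
  assumes "j < c * length u"
  shows "(concat (replicate c u) @ v) ! j = u ! (j mod length u)"
  using assms
proof (induction c arbitrary: j)
  case (Suc c)
  show ?case
  proof (cases "j < length u")
    case True
    then show ?thesis by (simp add: nth_append)
  next
    case False
    then have "j - length u < c * length u" using Suc.prems by simp
    from Suc.IH[OF this] show ?thesis using False
      by (simp add: nth_append le_mod_geq)
  qed
qed simp

lemma take_concat_replicate:
  assumes "b < c" and "l \<le> length u"
  shows "take (b * length u + l) (concat (replicate c u) @ v) = concat (replicate b u) @ take l u"
  using assms
proof (induction b arbitrary: c)
  case 0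
  then show ?case by (cases c) auto
next
  case (Suc b)
  then obtain c' where c: "c = Suc c'" "b < c'" by (cases c) auto
  then show ?case using Suc.IH[of c'] Suc.prems by (simp add: add.assoc)
qed

lemma word_map_replicate: "word_map f (concat (replicate b u)) = word_map f u ^^ b"
  by (induction b) (auto simp: funpow_swap1 fun_eq_iff)

text \<open>Periods need not be minimal, and \<open>0\<close> is a period of every sequence;
  positivity is therefore required separately where it matters.\<close>

definition has_period :: "nat \<Rightarrow> (int \<Rightarrow> 'a) \<Rightarrow> bool" where
  "has_period e \<xi> \<longleftrightarrow> (\<forall>j. \<xi> (j + int e) = \<xi> j)"

lemma has_period_multiple: "has_period e \<xi> \<Longrightarrow> \<xi> (j + int e * c) = \<xi> j"
proof (induction c rule: int_induct[of _ 0])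
  case (step1 i)
  have "\<xi> (j + int e * (i + 1)) = \<xi> ((j + int e * i) + int e)" by (simp add: algebra_simps)
  with step1 show ?case by (simp add: has_period_def)
next
  case (step2 i)
  have "\<xi> (j + int e * i) = \<xi> ((j + int e * (i - 1)) + int e)" by (simp add: algebra_simps)
  with step2 show ?case by (simp add: has_period_def)
qed simp

lemma has_period_mod: "has_period e \<xi> \<Longrightarrow> 0 < e \<Longrightarrow> \<xi> (int (nat (j mod int e))) = \<xi> j"
  using has_period_multiple[of e \<xi> "j mod int e" "j div int e"] by simp

text \<open>Since \<open>\<xi>\<close> repeats with period \<open>p\<close>, a shift by
  \<open>e\<close> has to be tested only on one stretch of length \<open>p\<close>.\<close>

lemma has_periodI_window:
  assumes "has_period p \<xi>" "0 < p" and "\<And>i. i < p \<Longrightarrow> \<xi> (int (i + e)) = \<xi> (int i)"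
  shows "has_period e \<xi>"
  unfolding has_period_def
proof
  fix j
  define i where "i = nat (j mod int p)"
  have j: "j = int i + int p * (j div int p)" and "i < p"
    using \<open>0 < p\<close> by (auto simp: i_def nat_less_iff)
  have "\<xi> (j + int e) = \<xi> (int (i + e) + int p * (j div int p))" by (subst j) (simp add: algebra_simps)
  also have "\<dots> = \<xi> (int i)" using assms(3)[OF \<open>i < p\<close>] has_period_multiple[OF assms(1)] by simp
  also have "\<dots> = \<xi> j" using j has_period_multiple[OF assms(1)] by metis
  finally show "\<xi> (j + int e) = \<xi> j" .
qed

text \<open>In the spirit of the Fine-Wilf theorem: on the common window \<open>\<xi>\<close>
  inherits the period \<open>e\<close> of \<open>\<eta>\<close> for one full stretch of length
  \<open>p\<close>, hence everywhere. Both sequences are then determined by their first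
  \<open>e\<close> letters.\<close>

lemma periodic_agree:
  assumes "has_period p \<xi>" "0 < p" "has_period e \<eta>" "0 < e" "p + e \<le> X"
    and agree: "\<And>i. i < X \<Longrightarrow> \<xi> (int i) = \<eta> (int i)"
  shows "\<xi> = \<eta>"
proof
  have "\<xi> (int (i + e)) = \<xi> (int i)" if "i < p" for i
    using agree[of "i + e"] agree[of i] that assms(3,5) by (simp add: has_period_def)
  then have e: "has_period e \<xi>" by (rule has_periodI_window[OF assms(1,2)])
  fix j
  have "nat (j mod int e) < X" using assms(4,5) by (simp add: nat_less_iff) (meson pos_mod_bound less_le_trans of_nat_0_less_iff of_nat_le_iff le_add2 le_trans)
  then have "\<xi> (int (nat (j mod int e))) = \<eta> (int (nat (j mod int e)))" by (rule agree)
  then show "\<xi> j = \<eta> j" using has_period_mod e assms(3,4) by metis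
qed

lemma generated_by_nat: "u \<noteq> [] \<Longrightarrow> generated_by u (int i) = u ! (i mod length u)"
  by (simp add: generated_by_def flip: zmod_int)

lemma generated_by_period: "has_period (length u) (generated_by u)"
  by (simp add: has_period_def generated_by_def)

lemma generated_by_shift_space:
  assumes "u \<noteq> []" "set u \<subseteq> {1..k}"
  shows "generated_by u \<in> shift_space k"
proof -
  have "generated_by u j \<in> set u" for j
    using assms(1) unfolding generated_by_def by (intro nth_mem) (simp add: nat_less_iff)
  then have "generated_by u j \<in> {1..k}" for j using assms(2) by blast
  then show ?thesis by (simp add: shift_space_def)
qed

section \<open>Covering by shrinking balls, and measures on periodic orbits\<close>

text \<open>Pigeonhole: among \<open>Suc B\<close> points at mutual distance at least
  \<open>\<delta>\<close>, two would share a ball once the radius is below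
  \<open>\<delta> / 2\<close>. The centers may change with \<open>i\<close>.\<close>

lemma finite_if_covered_by_balls:
  fixes X :: "'a :: metric_space set"
  assumes cover: "\<And>i. \<exists>A. finite A \<and> card A \<le> B \<and> X \<subseteq> (\<Union>c\<in>A. cball c (r i))"
    and r: "r \<longlonglongrightarrow> 0"
  shows "finite X"
proof (rule ccontr)
  assume "infinite X"
  then obtain Y where Y: "Y \<subseteq> X" "finite Y" "card Y = Suc B"
    using infinite_arbitrarily_large by blast
  have "\<exists>\<delta>>0. \<forall>x\<in>Y. \<forall>y\<in>Y. x \<noteq> y \<longrightarrow> \<delta> \<le> dist x y"
  proof -
    define P where "P = (\<lambda>(x, y). dist x y) ` {(x, y). x \<in> Y \<and> y \<in> Y \<and> x \<noteq> y}"
    have "finite P"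
      unfolding P_def by (rule finite_imageI, rule finite_subset[of _ "Y \<times> Y"]) (use Y in auto)
    \<comment> \<open>The inserted \<open>1\<close> covers the case of a single point, in which
      there are no distances to compare.\<close>
    then have "0 < Min (insert 1 P)" by (subst Min_gr_iff) (auto simp: P_def)
    moreover have "Min (insert 1 P) \<le> dist x y" if "x \<in> Y" "y \<in> Y" "x \<noteq> y" for x y
      using that \<open>finite P\<close> by (intro Min_le) (auto simp: P_def)
    ultimately show ?thesis by blast
  qed
  then obtain \<delta> where \<delta>: "0 < \<delta>" "\<And>x y. x \<in> Y \<Longrightarrow> y \<in> Y \<Longrightarrow> x \<noteq> y \<Longrightarrow> \<delta> \<le> dist x y"
    by blast
  have "\<forall>\<^sub>F i in sequentially. r i < \<delta> / 2" using r \<delta>(1) by (intro order_tendstoD) auto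
  then obtain i where i: "r i < \<delta> / 2" by (auto dest: eventually_happens)
  obtain A where A: "finite A" "card A \<le> B" "X \<subseteq> (\<Union>c\<in>A. cball c (r i))" using cover by blast
  then have "\<forall>x\<in>Y. \<exists>c\<in>A. dist c x \<le> r i" using Y(1) by fastforce
  then obtain h where h: "\<And>x. x \<in> Y \<Longrightarrow> h x \<in> A" "\<And>x. x \<in> Y \<Longrightarrow> dist (h x) x \<le> r i" by metis
  have "\<not> inj_on h Y"
    using card_inj_on_le[of h Y A] h(1) A Y(3) by auto
  then obtain x y where xy: "x \<in> Y" "y \<in> Y" "x \<noteq> y" "h x = h y" unfolding inj_on_def by blast
  have "dist x y \<le> dist (h x) x + dist (h y) y"
    unfolding xy(4) by (metis dist_commute dist_triangle)
  also have "\<dots> < \<delta>" using h(2)[OF xy(1)] h(2)[OF xy(2)] i by linarith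
  finally show False using \<delta>(2) xy by fastforce
qed

lemma funpow_mod_period: "(T ^^ p) z = z \<Longrightarrow> (T ^^ j) z = (T ^^ (j mod p)) z"
proof -
  assume fixed: "(T ^^ p) z = z"
  then have "(T ^^ (c * p)) z = z" for c by (induction c) (auto simp: funpow_add)
  moreover have "(T ^^ j) z = (T ^^ (j mod p)) ((T ^^ (j div p * p)) z)"
    by (metis comp_apply funpow_add mod_div_mult_eq)
  ultimately show ?thesis by simp
qed

lemma measurable_orbit:
  assumes "\<And>j. j < p \<Longrightarrow> (skew_product f ^^ j) z \<in> skew_space k"
  shows "(\<lambda>l. (skew_product f ^^ l) z) \<in> uniform_count_measure {..<p} \<rightarrow>\<^sub>M skew_borel k"
  using assms
  by (auto simp: measurable_def space_uniform_count_measure sets_uniform_count_measure space_skew_borel)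

lemma prob_space_orbit_measure:
  assumes "0 < p" and "\<And>j. j < p \<Longrightarrow> (skew_product f ^^ j) z \<in> skew_space k"
  shows "prob_space (orbit_measure k f p z)"
proof -
  have "prob_space (uniform_count_measure {..<p})"
    using \<open>0 < p\<close> by (intro prob_space_uniform_count_measure) auto
  then show ?thesis
    unfolding orbit_measure_def by (rule prob_space.prob_space_distr[OF _ measurable_orbit[OF assms(2)]])
qed

lemma measure_orbit_measure:
  assumes "\<And>j. j < p \<Longrightarrow> (skew_product f ^^ j) z \<in> skew_space k" and "D \<in> sets (skew_borel k)"
  shows "measure (orbit_measure k f p z) D = card {j. j < p \<and> (skew_product f ^^ j) z \<in> D} / p"
proof -
  have "(\<lambda>l. (skew_product f ^^ l) z) -` D \<inter> space (uniform_count_measure {..<p}) =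
      {j. j < p \<and> (skew_product f ^^ j) z \<in> D}"
    by (auto simp: space_uniform_count_measure)
  then show ?thesis
    unfolding orbit_measure_def using measure_distr[OF measurable_orbit[OF assms(1)] assms(2)]
    by (simp add: measure_uniform_count_measure subset_eq)
qed

text \<open>Counting step of an induction: if a proportion \<open>1 - s\<close> of a stretch of
  length \<open>X\<close> is good, appending a tail of length \<open>R\<close> lowers the proportion
  by at most \<open>R / X\<close>. The slack is \<open>s * R + R * R / X\<close>.\<close>

lemma real_tail_loss:
  fixes X R s :: real
  assumes "0 < X" "0 \<le> R" "0 \<le> s"
  shows "(1 - (s + R / X)) * (X + R) \<le> (1 - s) * X"
proof -
  have "(1 - (s + R / X)) * (X + R) = (1 - s) * X - s * R - R * R / X"
    using assms(1) by (simp add: field_simps)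
  moreover have "0 \<le> s * R" "0 \<le> R * R / X" using assms by simp_all
  ultimately show ?thesis by linarith
qed

section \<open>The tower structure of the periodic orbits\<close>

text \<open>The witness \<open>\<gamma>\<close> of the last GIKN condition becomes a parameter, so
  that its tail sums can be named; \<open>L\<close> is the largest stretching of a single
  letter.\<close>

locale gikn_pattern =
  fixes k :: nat and f :: "nat \<Rightarrow> complex \<Rightarrow> complex" and w :: "nat \<Rightarrow> nat list"
    and q :: "nat \<Rightarrow> complex" and J :: "nat \<Rightarrow> complex set" and m :: "nat \<Rightarrow> nat"
    and \<alpha> :: "nat \<Rightarrow> nat list" and L :: real and \<gamma> :: "nat \<Rightarrow> real"
  assumes k: "1 \<le> k" and diffeo: "j \<in> {1..k} \<Longrightarrow> circle_C1_diffeo (f j)"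
    and pattern: "repetitive_pattern k f w q J m \<alpha>" and conditions: "GIKN_conditions k f w q J m \<alpha>"
    and L: "L = (MAX j\<in>{1..k}. SUP x\<in>circle. abs_deriv (f j) x)"
    and summable_\<gamma>: "summable \<gamma>" and J_less_\<gamma>: "L ^ length (w n) * arc_length (J n) < \<gamma> n"
begin

abbreviation len :: "nat \<Rightarrow> nat" where "len n \<equiv> length (w n)"

abbreviation ratio :: "nat \<Rightarrow> real" where "ratio n \<equiv> tail_ratio w m \<alpha> n"

lemma w_letters: "set (w n) \<subseteq> {1..k}" and w_nonempty: "w n \<noteq> []" and len_pos: "0 < len n"
  using pattern unfolding repetitive_pattern_def by auto

lemma J_interval: "circle_interval (J n)" and q_mem: "q n \<in> J n" and J_Suc: "J (Suc n) \<subseteq> J n"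
  and J_pos: "0 < arc_length (J (Suc n))" and J_less: "arc_length (J (Suc n)) < arc_length (J n)"
  using pattern unfolding repetitive_pattern_def by blast+

lemma J_lim: "(\<lambda>n. arc_length (J n)) \<longlonglongrightarrow> 0"
  using pattern unfolding repetitive_pattern_def by blast

lemma q_fixed: "word_map f (w n) (q n) = q n"
  and contracting: "x \<in> J n \<Longrightarrow> abs_deriv (word_map f (w n)) x < 1"
  using pattern unfolding repetitive_pattern_def by blast+

lemma w_Suc: "w (Suc n) = concat (replicate (m (Suc n)) (w n)) @ \<alpha> (Suc n)"
  and m_Suc: "2 \<le> m (Suc n)"
  using pattern unfolding repetitive_pattern_def by (force, force)

lemma summable_ratio: "summable (\<lambda>n. ratio (Suc n))"
  using pattern unfolding repetitive_pattern_def by blast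

lemma J_invariant: "word_map f (w (Suc n)) ` J n \<subseteq> J n"
  and contracting_Suc: "x \<in> J n \<Longrightarrow> abs_deriv (word_map f (w (Suc n))) x < 1"
  and q_Suc_mem: "q (Suc n) \<in> J n"
  using conditions unfolding GIKN_conditions_def by blast+

lemma J_circle: "J n \<subseteq> circle"
  using J_interval[of n] by (auto simp: circle_interval_def)

lemma q_circle: "q n \<in> circle" using q_mem J_circle by blast

lemma letter_lift:
  assumes "j \<in> {1..k}"
  obtains F F' where "circle_lift (f j) F F'" and "\<And>t. \<bar>F' t\<bar> \<le> L"
proof -
  have C1: "circle_C1 (f j)" using diffeo[OF assms] by (simp add: circle_C1_diffeo_def)
  then obtain F F' where lift: "circle_lift (f j) F F'" by (rule circle_lift_exists)
  have "\<bar>F' t\<bar> \<le> L" for t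
  proof -
    have "\<bar>F' t\<bar> = abs_deriv (f j) (cis t)" by (rule abs_deriv_lift[OF lift, symmetric])
    also have "\<dots> \<le> (SUP x\<in>circle. abs_deriv (f j) x)"
      by (rule cSUP_upper[OF _ bdd_above_abs_deriv[OF C1]]) simp
    also have "\<dots> \<le> L" unfolding L using assms by (intro Max_ge) auto
    finally show ?thesis .
  qed
  with lift show ?thesis by (rule that)
qed

lemma L_ge_1: "1 \<le> L"
proof -
  have one: "1 \<in> {1..k}" using k by simp
  obtain F F' where lift: "circle_lift (f 1) F F'" and bound: "\<And>t. \<bar>F' t\<bar> \<le> L"
    by (rule letter_lift[OF one]) (rule that)
  have "f 1 ` circle = circle"
    using diffeo[OF one] unfolding circle_C1_diffeo_def bij_betw_def by blast
  with lift bound show ?thesis by (rule one_le_deriv_bound)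
qed

text \<open>By the chain rule each letter contributes a factor of at most \<open>L\<close>; the lift
  of the first letter is the innermost one.\<close>

lemma word_lift:
  assumes "set u \<subseteq> {1..k}"
  shows "\<exists>F F'. circle_lift (word_map f u) F F' \<and> (\<forall>t. \<bar>F' t\<bar> \<le> L ^ length u)"
  using assms
proof (induction u)
  case Nil
  have "\<forall>t::real. \<bar>(\<lambda>_. 1::real) t\<bar> \<le> L ^ length []" by simp
  then show ?case using circle_lift_id unfolding fold_Nil by blast
next
  case (Cons a u)
  then obtain G G' where G: "circle_lift (word_map f u) G G'" "\<And>t. \<bar>G' t\<bar> \<le> L ^ length u" by auto
  have a: "a \<in> {1..k}" using Cons.prems by simp
  obtain F F' where F: "circle_lift (f a) F F'" "\<And>t. \<bar>F' t\<bar> \<le> L" by (rule letter_lift[OF a]) (rule that)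
  have "\<bar>G' (F t) * F' t\<bar> \<le> L ^ length (a # u)" for t
  proof -
    have "\<bar>G' (F t)\<bar> * \<bar>F' t\<bar> \<le> L ^ length u * L" using G(2) F(2) L_ge_1 by (intro mult_mono) auto
    then show ?thesis by (simp add: abs_mult mult.commute)
  qed
  with circle_lift_compose[OF F(1) G(1)] show ?case unfolding fold_Cons by blast
qed

lemma word_map_circle: "set u \<subseteq> {1..k} \<Longrightarrow> x \<in> circle \<Longrightarrow> word_map f u x \<in> circle"
  using word_lift circle_lift_maps by metis

lemma unique_fixpoint:
  assumes "arc_length (J n) < pi" and "set u \<subseteq> {1..k}"
    and "\<And>x. x \<in> J n \<Longrightarrow> abs_deriv (word_map f u) x < 1"
    and "x \<in> J n" "y \<in> J n" "word_map f u x = x" "word_map f u y = y"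
  shows "x = y"
proof -
  obtain F F' where lift: "circle_lift (word_map f u) F F'" using word_lift[OF assms(2)] by blast
  show ?thesis by (rule contraction_unique_fixpoint[OF lift J_interval assms(1,3-7)])
qed

section \<open>Shadowing of the periodic orbits of successive levels\<close>

text \<open>For \<open>j\<close> up to \<open>len n\<close> this is the fiber coordinate of the
  \<open>n\<close>-th periodic orbit at time \<open>j\<close>, see
  \<open>orbit_point\<close>.\<close>

definition pt :: "nat \<Rightarrow> nat \<Rightarrow> complex" where
  "pt n j = word_map f (take j (w n)) (q n)"

lemma pt_circle: "pt n j \<in> circle"
  unfolding pt_def by (rule word_map_circle[OF subset_trans[OF set_take_subset w_letters] q_circle])

lemma orbit_point:
  "j \<le> len n \<Longrightarrow> (skew_product f ^^ j) (generated_by (w n), q n) =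
     (\<lambda>i. generated_by (w n) (i + int j), pt n j)"
proof (induction j)
  case 0
  then show ?case by (simp add: pt_def)
next
  case (Suc j)
  then have "generated_by (w n) (int j) = w n ! j" by (simp add: generated_by_nat w_nonempty)
  moreover have "pt n (Suc j) = f (w n ! j) (pt n j)"
    using Suc.prems by (simp add: pt_def take_Suc_conv_app_nth)
  ultimately show ?case using Suc by (simp add: skew_product_def left_shift_def algebra_simps)
qed

lemma orbit_in_skew_space:
  assumes "j \<le> len n"
  shows "(skew_product f ^^ j) (generated_by (w n), q n) \<in> skew_space k"
proof -
  have "generated_by (w n) \<in> shift_space k" by (intro generated_by_shift_space w_nonempty w_letters)
  then show ?thesis using pt_circle by (simp add: orbit_point[OF assms] skew_space_def shift_space_def)
qed

text \<open>The map of the word \<open>w (n + 1)\<close> contracts \<open>J n\<close> into itself, whereas nothing guarantees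
  that it maps \<open>J (n + 1)\<close> into itself; hence the index shift.\<close>

lemma pt_step:
  assumes small: "arc_length (J n) < pi" and b: "b < m (Suc (Suc n))" and l: "l \<le> len (Suc n)"
  shows "arc_close (\<gamma> (Suc n)) (pt (Suc n) l) (pt (Suc (Suc n)) (b * len (Suc n) + l))"
proof -
  let ?N = "Suc n" and ?g = "word_map f (w (Suc n))"
  obtain F F' where lift: "circle_lift ?g F F'" using word_lift[OF w_letters] by blast
  have small': "arc_length (J ?N) < pi" using J_less[of n] small by linarith
  have "arc_close (arc_length (J ?N)) (q ?N) (q (Suc ?N))"
    using small' pi_gt_zero by (intro circle_interval_diameter J_interval q_mem q_Suc_mem) linarith
  \<comment> \<open>\<open>?g\<close> contracts \<open>J n\<close> into itself and fixes
    \<open>q ?N\<close>, so repeating it cannot carry \<open>q (Suc ?N)\<close> further away than it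
    was at the start.\<close>
  then have "arc_close (arc_length (J ?N)) (q ?N) ((?g ^^ b) (q (Suc ?N)))"
    using contraction_iterates_close[OF lift J_interval small contracting_Suc J_invariant
        q_Suc_mem _ q_fixed _ small', of "q (Suc ?N)" b] q_Suc_mem[of ?N] J_Suc[of n] by blast
  moreover obtain G G' where G: "circle_lift (word_map f (take l (w ?N))) G G'"
      "\<And>t. \<bar>G' t\<bar> \<le> L ^ length (take l (w ?N))"
    using word_lift[OF subset_trans[OF set_take_subset w_letters]] by blast
  ultimately have "arc_close (L ^ length (take l (w ?N)) * arc_length (J ?N)) (pt ?N l)
      (word_map f (take l (w ?N)) ((?g ^^ b) (q (Suc ?N))))"
    unfolding pt_def by (intro arc_close_lipschitz[OF G(1) G(2) q_circle])
  moreover have "pt (Suc ?N) (b * len ?N + l) = word_map f (take l (w ?N)) ((?g ^^ b) (q (Suc ?N)))"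
    unfolding pt_def w_Suc[of ?N] take_concat_replicate[OF b l] by (simp add: word_map_replicate)
  \<comment> \<open>A prefix stretches by at most the power of \<open>L\<close> belonging to the
    full word, and that is what \<open>\<gamma>\<close> is assumed to control.\<close>
  moreover have "L ^ length (take l (w ?N)) * arc_length (J ?N) \<le> \<gamma> ?N"
  proof -
    have "L ^ length (take l (w ?N)) * arc_length (J ?N) \<le> L ^ len ?N * arc_length (J ?N)"
      using L_ge_1 J_pos[of n] by (intro mult_right_mono power_increasing) auto
    then show ?thesis using J_less_\<gamma>[of ?N] by linarith
  qed
  ultimately show ?thesis using arc_close_mono by metis
qed

lemma len_Suc: "len (Suc n) = m (Suc n) * len n + length (\<alpha> (Suc n))"
  by (simp add: w_Suc length_concat_replicate)

lemma w_Suc_nth: "j < m (Suc n) * len n \<Longrightarrow> w (Suc n) ! j = w n ! (j mod len n)"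
  unfolding w_Suc by (rule nth_concat_replicate)

lemma ratio_nonneg: "0 \<le> ratio n" by (simp add: tail_ratio_def)

lemma \<gamma>_pos: "0 < \<gamma> (Suc n)"
proof -
  have "0 \<le> L ^ len (Suc n) * arc_length (J (Suc n))" using J_pos[of n] L_ge_1 by simp
  then show ?thesis using J_less_\<gamma>[of "Suc n"] by linarith
qed

text \<open>The position \<open>j\<close> of the \<open>N\<close>-th word lies in the copy number \<open>a\<close> of a double block
  \<open>w n w n\<close>, at offset \<open>l\<close>.\<close>

definition shadowed :: "nat \<Rightarrow> nat \<Rightarrow> nat \<Rightarrow> bool" where
  "shadowed n N j \<longleftrightarrow> (\<exists>l<len n. \<exists>a<2. \<exists>s. s + l + a * len n = j \<and> s + 2 * len n \<le> len N \<and>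
     (\<forall>i<2 * len n. w N ! (s + i) = w n ! (i mod len n)) \<and>
     arc_close (\<Sum>i=n..<N. \<gamma> i) (pt n l) (pt N j))"

lemma shadowed_base:
  assumes small: "arc_length (J n) < pi" and j: "j < m (Suc (Suc n)) * len (Suc n)"
  shows "shadowed (Suc n) (Suc (Suc n)) j"
proof -
  let ?N = "Suc n"
  define b where "b = j div len ?N"
  define l where "l = j mod len ?N"
  \<comment> \<open>The double block starts one copy before that of \<open>j\<close>. The first copy
    has no predecessor and is paired with its successor, which exists since there are at least two
    copies.\<close>
  define a where "a = (if b = 0 then 0 else 1 :: nat)"
  have jbl: "j = b * len ?N + l" and l: "l < len ?N"
    using len_pos[of ?N] by (auto simp: b_def l_def)
  have b: "b < m (Suc ?N)" using j len_pos[of ?N] unfolding b_def by (simp add: less_mult_imp_div_less)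
  have ab: "a \<le> b" "b - a + 2 \<le> m (Suc ?N)" "a < 2" using b m_Suc[of ?N] by (auto simp: a_def)
  define s where "s = (b - a) * len ?N"
  have "s + l + a * len ?N = j"
  proof -
    have "s + a * len ?N = b * len ?N" using ab(1) by (simp add: s_def flip: distrib_right)
    then show ?thesis using jbl by simp
  qed
  moreover have sm: "s + 2 * len ?N \<le> m (Suc ?N) * len ?N"
    using mult_right_mono[OF ab(2), of "len ?N"] by (simp add: s_def distrib_right)
  then have "s + 2 * len ?N \<le> len (Suc ?N)" unfolding len_Suc[of ?N] by linarith
  moreover have "w (Suc ?N) ! (s + i) = w ?N ! (i mod len ?N)" if "i < 2 * len ?N" for i
    using w_Suc_nth[of "s + i" ?N] that sm by (simp add: s_def)
  moreover have "arc_close (\<Sum>i=?N..<Suc ?N. \<gamma> i) (pt ?N l) (pt (Suc ?N) j)"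
    using pt_step[OF small b, of l] l jbl by simp
  ultimately show ?thesis using l ab(3) unfolding shadowed_def by blast
qed

text \<open>Copy number \<open>b\<close> of \<open>w N\<close> carries the window along verbatim,
  and by \<open>pt_step\<close> the fiber coordinate drifts by at most \<open>\<gamma> N\<close>
  more.\<close>

lemma shadowed_step:
  assumes small: "arc_length (J n) < pi" and N: "n < N" and j: "j < len N" and sh: "shadowed (Suc n) N j"
    and b: "b < m (Suc N)"
  shows "shadowed (Suc n) (Suc N) (b * len N + j)"
proof -
  let ?n = "Suc n"
  obtain l a s where l: "l < len ?n" "a < 2" and s: "s + l + a * len ?n = j" "s + 2 * len ?n \<le> len N"
    and win: "\<forall>i<2 * len ?n. w N ! (s + i) = w ?n ! (i mod len ?n)"
    and close: "arc_close (\<Sum>i=?n..<N. \<gamma> i) (pt ?n l) (pt N j)"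
    using sh unfolding shadowed_def by blast
  \<comment> \<open>\<open>pt_step\<close> compares two levels that both have a predecessor, and the
    arc of that predecessor must be short.\<close>
  obtain N' where N': "N = Suc N'" "n \<le> N'" using N by (cases N) auto
  have "arc_length (J N') \<le> arc_length (J n)"
    using lift_Suc_antimono_le[of "\<lambda>n. arc_length (J n)", OF less_imp_le[OF J_less] N'(2)] .
  then have "arc_close (\<gamma> N) (pt N j) (pt (Suc N) (b * len N + j))"
    using pt_step[of N' b j] small b j unfolding N'(1) by simp
  then have "arc_close (\<Sum>i=?n..<Suc N. \<gamma> i) (pt ?n l) (pt (Suc N) (b * len N + j))"
    using arc_close_trans[OF close] N by (simp add: sum.atLeastLessThan_Suc)
  moreover have bm: "b * len N + len N \<le> m (Suc N) * len N"
    using mult_right_mono[of "Suc b" "m (Suc N)" "len N"] b by simp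
  then have "(b * len N + s) + 2 * len ?n \<le> len (Suc N)" using s(2) unfolding len_Suc[of N] by linarith
  moreover have "w (Suc N) ! (b * len N + s + i) = w ?n ! (i mod len ?n)" if i: "i < 2 * len ?n" for i
  proof -
    have "s + i < len N" using s(2) i by linarith
    then have "w (Suc N) ! (b * len N + (s + i)) = w N ! (s + i)"
      using w_Suc_nth[of "b * len N + (s + i)" N] bm by simp
    then show ?thesis using win i by (simp add: add.assoc)
  qed
  moreover have "(b * len N + s) + l + a * len ?n = b * len N + j" using s(1) by simp
  ultimately show ?thesis using l unfolding shadowed_def by blast
qed

text \<open>Every copy of the previous word contributes all of its shadowed positions, so one level
  up only the tail is lost, at the cost of one ratio by \<open>real_tail_loss\<close>.\<close>

lemma card_shadowed:
  assumes small: "arc_length (J n) < pi"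
  shows "(1 - (\<Sum>i\<le>d. ratio (Suc (Suc n) + i))) * len (Suc (Suc n) + d)
    \<le> card {j. j < len (Suc (Suc n) + d) \<and> shadowed (Suc n) (Suc (Suc n) + d) j}"
proof (induction d)
  case 0
  let ?N = "Suc n"
  define X where "X = m (Suc ?N) * len ?N"
  have "0 < X" using m_Suc[of ?N] len_pos[of ?N] by (simp add: X_def)
  have "{..<X} \<subseteq> {j. j < len (Suc ?N) \<and> shadowed ?N (Suc ?N) j}"
    using shadowed_base[OF small] by (auto simp: X_def len_Suc[of ?N])
  from card_mono[OF _ this] have "X \<le> card {j. j < len (Suc ?N) \<and> shadowed ?N (Suc ?N) j}" by simp
  moreover have "(1 - ratio (Suc ?N)) * len (Suc ?N) \<le> X"
    using real_tail_loss[of X "length (\<alpha> (Suc ?N))" 0] \<open>0 < X\<close>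
    by (simp add: len_Suc[of ?N] X_def tail_ratio_def)
  ultimately show ?case by simp
next
  case (Suc d)
  define N where "N = Suc (Suc n) + d"
  define S where "S = {j. j < len N \<and> shadowed (Suc n) N j}"
  define \<sigma> where "\<sigma> = (\<Sum>i\<le>d. ratio (Suc (Suc n) + i))"
  define X where "X = m (Suc N) * len N"
  have "0 < X" using m_Suc[of N] len_pos[of N] by (simp add: X_def)
  let ?h = "\<lambda>(b, j). b * len N + j"
  have inj: "inj_on ?h ({..<m (Suc N)} \<times> S)"
  proof (rule inj_onI, clarify)
    fix b j b' j' assume "j \<in> S" "j' \<in> S" and eq: "b * len N + j = b' * len N + j'"
    then have j: "j < len N" "j' < len N" by (auto simp: S_def)
    have "(b * len N + j) div len N = b" "(b * len N + j) mod len N = j"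
      "(b' * len N + j') div len N = b'" "(b' * len N + j') mod len N = j'"
      using j w_nonempty[of N] by simp_all
    then show "b = b' \<and> j = j'" using eq by metis
  qed
  have "?h ` ({..<m (Suc N)} \<times> S) \<subseteq> {j. j < len (Suc N) \<and> shadowed (Suc n) (Suc N) j}"
  proof
    fix x assume "x \<in> ?h ` ({..<m (Suc N)} \<times> S)"
    then obtain b j where x: "x = b * len N + j" and b: "b < m (Suc N)" and "j \<in> S" by auto
    then have j: "j < len N" "shadowed (Suc n) N j" by (auto simp: S_def)
    have "n < N" by (simp add: N_def)
    have "shadowed (Suc n) (Suc N) (b * len N + j)"
      by (rule shadowed_step[OF small \<open>n < N\<close> j b])
    moreover have "b * len N + len N \<le> m (Suc N) * len N"
      using mult_right_mono[of "Suc b" "m (Suc N)" "len N"] b by simp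
    then have "b * len N + j < len (Suc N)" using j unfolding len_Suc[of N] by linarith
    ultimately show "x \<in> {j. j < len (Suc N) \<and> shadowed (Suc n) (Suc N) j}" using x by simp
  qed
  from card_mono[OF _ this] have "m (Suc N) * card S \<le> card {j. j < len (Suc N) \<and> shadowed (Suc n) (Suc N) j}"
    using inj by (simp add: card_image card_cartesian_product)
  then have "real (m (Suc N)) * card S \<le> card {j. j < len (Suc N) \<and> shadowed (Suc n) (Suc N) j}"
    by (metis of_nat_le_iff of_nat_mult)
  moreover have "real (m (Suc N)) * ((1 - \<sigma>) * len N) \<le> real (m (Suc N)) * card S"
    using Suc by (intro mult_left_mono) (auto simp: S_def N_def \<sigma>_def)
  moreover have "(1 - (\<sigma> + ratio (Suc N))) * len (Suc N) \<le> (1 - \<sigma>) * X"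
  proof -
    have ratio_eq: "ratio (Suc N) = real (length (\<alpha> (Suc N))) / real X"
      by (simp add: tail_ratio_def X_def)
    have len_eq: "real (len (Suc N)) = real X + real (length (\<alpha> (Suc N)))"
      unfolding len_Suc[of N] X_def by simp
    have "0 \<le> \<sigma>" unfolding \<sigma>_def by (intro sum_nonneg ratio_nonneg)
    then show ?thesis unfolding ratio_eq len_eq using \<open>0 < X\<close> by (intro real_tail_loss) auto
  qed
  moreover have "(1 - \<sigma>) * X = real (m (Suc N)) * ((1 - \<sigma>) * len N)" by (simp add: X_def)
  ultimately have "(1 - (\<sigma> + ratio (Suc N))) * len (Suc N)
      \<le> card {j. j < len (Suc N) \<and> shadowed (Suc n) (Suc N) j}" by linarith
  moreover have "(\<Sum>i\<le>Suc d. ratio (Suc (Suc n) + i)) = \<sigma> + ratio (Suc N)"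
    by (simp add: N_def \<sigma>_def)
  moreover have "Suc (Suc n) + Suc d = Suc N" by (simp add: N_def)
  ultimately show ?case by (simp only:)
qed

section \<open>Towers: closed sets of almost full measure\<close>

definition \<Gamma> :: "nat \<Rightarrow> real" where "\<Gamma> n = (\<Sum>i. \<gamma> (i + n))"

text \<open>The sum begins at \<open>ratio (Suc n)\<close>, the loss in passing from
  \<open>w n\<close> to \<open>w (Suc n)\<close>.\<close>

definition \<Lambda> :: "nat \<Rightarrow> real" where "\<Lambda> n = (\<Sum>i. ratio (Suc (i + n)))"

lemma \<Gamma>_lim: "\<Gamma> \<longlonglongrightarrow> 0"
  unfolding \<Gamma>_def by (rule suminf_exist_split2[OF summable_\<gamma>])

lemma \<Lambda>_lim: "\<Lambda> \<longlonglongrightarrow> 0"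
  unfolding \<Lambda>_def by (rule suminf_exist_split2[OF summable_ratio])

lemma sum_\<gamma>_le: "(\<Sum>i=Suc n..<N. \<gamma> i) \<le> \<Gamma> (Suc n)"
proof (cases "Suc n \<le> N")
  case True
  have "(\<Sum>i=Suc n..<N. \<gamma> i) = (\<Sum>i<N - Suc n. \<gamma> (i + Suc n))"
    using True by (simp add: sum.atLeastLessThan_shift_0 atLeast0LessThan add.commute)
  also have "\<dots> \<le> \<Gamma> (Suc n)"
    unfolding \<Gamma>_def using summable_ignore_initial_segment[OF summable_\<gamma>, of "Suc n"] \<gamma>_pos
    by (intro sum_le_suminf) (auto intro: less_imp_le)
  finally show ?thesis .
next
  case False
  moreover have "0 \<le> \<Gamma> (Suc n)"
    unfolding \<Gamma>_def using summable_ignore_initial_segment[OF summable_\<gamma>, of "Suc n"] \<gamma>_pos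
    by (intro suminf_nonneg) (auto intro: less_imp_le)
  ultimately show ?thesis by simp
qed

lemma sum_ratio_le: "(\<Sum>i\<le>d. ratio (Suc n + i)) \<le> \<Lambda> n"
proof -
  have "(\<Sum>i<Suc d. ratio (Suc (i + n))) \<le> \<Lambda> n"
    unfolding \<Lambda>_def using summable_ignore_initial_segment[OF summable_ratio, of n] ratio_nonneg
    by (intro sum_le_suminf) auto
  then show ?thesis by (simp add: lessThan_Suc_atMost add.commute)
qed

text \<open>Reading two copies ensures that windows at two offsets below \<open>len n\<close> in the
  same copy still overlap on a full period, as \<open>has_periodI_window\<close> requires.\<close>

definition sees :: "nat \<Rightarrow> nat \<Rightarrow> nat \<Rightarrow> (int \<Rightarrow> nat) \<Rightarrow> bool" where
  "sees n l a \<xi> \<longleftrightarrow> (\<forall>i<2 * len n. \<xi> (int i - int (l + a * len n)) = w n ! (i mod len n))"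

text \<open>A continuous nonnegative function built to apply
  \<open>weak_star_limit_zero_set\<close>: each factor measures the failure at one pair of offset
  and copy, and the product vanishes as soon as one pair succeeds.\<close>

definition tower_defect :: "nat \<Rightarrow> (int \<Rightarrow> nat) \<times> complex \<Rightarrow> real" where
  "tower_defect n z = (\<Prod>l<len n. \<Prod>a<2.
     (\<Sum>i<2 * len n. \<bar>real (fst z (int i - int (l + a * len n))) - real (w n ! (i mod len n))\<bar>)
     + max 0 (dist (snd z) (pt n l) - \<Gamma> n))"

definition tower :: "nat \<Rightarrow> ((int \<Rightarrow> nat) \<times> complex) set" where
  "tower n = {z. tower_defect n z = 0}"

lemma tower_iff:
  "z \<in> tower n \<longleftrightarrow> (\<exists>l<len n. \<exists>a<2. sees n l a (fst z) \<and> dist (snd z) (pt n l) \<le> \<Gamma> n)"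
proof -
  have "(\<Sum>i<2 * len n. \<bar>real (fst z (int i - int (l + a * len n))) - real (w n ! (i mod len n))\<bar>)
      + max 0 (dist (snd z) (pt n l) - \<Gamma> n) = 0 \<longleftrightarrow> sees n l a (fst z) \<and> dist (snd z) (pt n l) \<le> \<Gamma> n" for l a
    by (subst add_nonneg_eq_0_iff) (auto simp: sum_nonneg sum_nonneg_eq_0_iff sees_def max_def)
  then show ?thesis unfolding tower_def tower_defect_def mem_Collect_eq
    by (simp only: prod_zero_iff finite_lessThan) auto
qed

lemma tower_defect_nonneg: "0 \<le> tower_defect n z"
  unfolding tower_defect_def by (intro prod_nonneg add_nonneg_nonneg sum_nonneg ballI) auto

lemma continuous_tower_defect: "continuous_on UNIV (tower_defect n)"
proof -
  have "continuous_on UNIV (\<lambda>z :: (int \<Rightarrow> nat) \<times> complex. fst z j)" for j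
    by (rule continuous_on_compose2[OF continuous_on_product_coordinates[of j] continuous_on_fst[OF continuous_on_id]]) auto
  then show ?thesis unfolding tower_defect_def
    by (intro continuous_intros continuous_on_prod continuous_on_sum)
qed

lemma shadowed_tower:
  assumes "j \<le> len N" and "shadowed (Suc n) N j"
  shows "(skew_product f ^^ j) (generated_by (w N), q N) \<in> tower (Suc n)"
proof -
  let ?n = "Suc n"
  obtain l a s where l: "l < len ?n" "a < 2" and s: "s + l + a * len ?n = j" "s + 2 * len ?n \<le> len N"
    and win: "\<forall>i<2 * len ?n. w N ! (s + i) = w ?n ! (i mod len ?n)"
    and close: "arc_close (\<Sum>i=?n..<N. \<gamma> i) (pt ?n l) (pt N j)"
    using assms(2) unfolding shadowed_def by blast
  have "sees ?n l a (\<lambda>i. generated_by (w N) (i + int j))"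
    unfolding sees_def
  proof (intro allI impI)
    fix i assume i: "i < 2 * len ?n"
    have "int i - int (l + a * len ?n) + int j = int (s + i)"
      using s(1)[symmetric] by simp
    then show "generated_by (w N) (int i - int (l + a * len ?n) + int j) = w ?n ! (i mod len ?n)"
      using win i s(2) by (simp only: generated_by_nat[OF w_nonempty]) simp
  qed
  moreover have "dist (pt N j) (pt ?n l) \<le> \<Gamma> ?n"
    using arc_close_dist[OF close pt_circle] sum_\<gamma>_le[of n N] by (simp add: dist_commute)
  ultimately show ?thesis using l unfolding tower_iff orbit_point[OF assms(1)] by auto
qed

definition orbit :: "nat \<Rightarrow> ((int \<Rightarrow> nat) \<times> complex) measure" where
  "orbit n = orbit_measure k f (len n) (generated_by (w n), q n)"

lemma prob_space_orbit: "prob_space (orbit n)"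
  unfolding orbit_def by (intro prob_space_orbit_measure len_pos orbit_in_skew_space less_imp_le)

lemma sets_orbit: "sets (orbit n) = sets (skew_borel k)"
  by (simp add: orbit_def orbit_measure_def)

text \<open>The bound does not depend on \<open>d\<close>, so it survives in the weak-star
  limit.\<close>

lemma measure_orbit_tower:
  assumes small: "arc_length (J n) < pi"
  shows "1 - \<Lambda> (Suc n) \<le> measure (orbit (Suc (Suc n) + d)) (tower (Suc n) \<inter> skew_space k)"
proof -
  define N where "N = Suc (Suc n) + d"
  let ?D = "tower (Suc n) \<inter> skew_space k"
  let ?O = "\<lambda>j. (skew_product f ^^ j) (generated_by (w N), q N)"
  have "(1 - \<Lambda> (Suc n)) * len N \<le> (1 - (\<Sum>i\<le>d. ratio (Suc (Suc n) + i))) * len N"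
    using sum_ratio_le[of "Suc n" d] by (intro mult_right_mono) auto
  also have "\<dots> \<le> card {j. j < len N \<and> shadowed (Suc n) N j}"
    unfolding N_def by (rule card_shadowed[OF small])
  also have "\<dots> \<le> card {j. j < len N \<and> ?O j \<in> ?D}"
    unfolding of_nat_le_iff using shadowed_tower orbit_in_skew_space
    by (intro card_mono) (auto simp: less_imp_le)
  finally have "1 - \<Lambda> (Suc n) \<le> card {j. j < len N \<and> ?O j \<in> ?D} / len N"
    using len_pos[of N] by (simp add: field_simps)
  also have "\<dots> = measure (orbit N) ?D"
    unfolding orbit_def tower_def
    by (intro measure_orbit_measure[symmetric] orbit_in_skew_space zero_set_sets
        continuous_tower_defect less_imp_le)
  finally show ?thesis by (simp add: N_def)
qed

section \<open>Periods of the words and the size of tower fibers\<close>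

text \<open>The same stretch of \<open>\<xi>\<close> spells \<open>w n w n\<close> from two starting
  points, which makes their difference a period of the repeated word.\<close>

lemma sees_period:
  assumes "sees n l a \<xi>" "sees n l' a \<xi>" "l < l'" "l' < len n"
  shows "has_period (l' - l) (generated_by (w n))"
proof (rule has_periodI_window[OF generated_by_period len_pos])
  fix i assume i: "i < len n"
  have "i + (l' - l) < 2 * len n" using assms(4) i by linarith
  then have "w n ! ((i + (l' - l)) mod len n) = \<xi> (int (i + (l' - l)) - int (l' + a * len n))"
    using assms(2) unfolding sees_def by metis
  also have "int (i + (l' - l)) - int (l' + a * len n) = int i - int (l + a * len n)"
    using assms(3) by (simp add: of_nat_diff)
  also have "\<xi> \<dots> = w n ! (i mod len n)" using assms(1) i unfolding sees_def by simp
  finally show "generated_by (w n) (int (i + (l' - l))) = generated_by (w n) (int i)"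
    unfolding generated_by_nat[OF w_nonempty] .
qed

text \<open>The factor 4 leaves room for a tail as long as the repeated block in
  \<open>same_sequence_if_short_period\<close>; without short periods it leaves at most four offsets
  per copy in \<open>card_sees\<close>.\<close>

definition short_period :: "nat \<Rightarrow> bool" where
  "short_period n \<longleftrightarrow> (\<exists>e>0. 4 * e \<le> len n \<and> has_period e (generated_by (w n)))"

text \<open>Distinct offsets differ by more than a quarter of \<open>len n\<close>, so they fall
  into distinct classes of \<open>4 * l div len n\<close>, of which there are four.\<close>

lemma card_sees:
  assumes "\<not> short_period n"
  shows "card {l. l < len n \<and> sees n l a \<xi>} \<le> 4"
proof -
  let ?S = "{l. l < len n \<and> sees n l a \<xi>}" and ?h = "\<lambda>l. 4 * l div len n"
  have less: "?h l < ?h l'" if "l \<in> ?S" "l' \<in> ?S" "l < l'" for l l'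
  proof -
    have "has_period (l' - l) (generated_by (w n))" using that sees_period by auto
    then have "len n < 4 * (l' - l)" using assms that(3) unfolding short_period_def
      by (meson not_le zero_less_diff)
    then have "4 * l + len n \<le> 4 * l'" using that(3) by linarith
    then have "(4 * l + len n) div len n \<le> ?h l'" by (rule div_le_mono)
    then show ?thesis using len_pos[of n] by simp
  qed
  have "inj_on ?h ?S"
    by (rule linorder_inj_onI) (use less in \<open>auto simp: less_imp_neq\<close>)
  moreover have "?h ` ?S \<subseteq> {..<4}"
    using len_pos[of n] by (auto simp: less_mult_imp_div_less)
  ultimately show ?thesis using card_inj_on_le[of ?h ?S "{..<4}"] by simp
qed

text \<open>Eight is two copies times four offsets.\<close>

lemma tower_fiber_cover:
  assumes "\<not> short_period n"
  shows "\<exists>A. finite A \<and> card A \<le> 8 \<and> {x. (\<xi>, x) \<in> tower n} \<subseteq> (\<Union>c\<in>A. cball c (\<Gamma> n))"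
proof -
  define S where "S a = {l. l < len n \<and> sees n l a \<xi>}" for a
  define A where "A = pt n ` (S 0 \<union> S 1)"
  have "finite (S a)" for a by (simp add: S_def)
  moreover have "card A \<le> 8"
  proof -
    have "card A \<le> card (S 0 \<union> S 1)" unfolding A_def by (rule card_image_le) (simp add: S_def)
    also have "\<dots> \<le> card (S 0) + card (S 1)" by (rule card_Un_le)
    also have "\<dots> \<le> 8" using card_sees[OF assms, of 0 \<xi>] card_sees[OF assms, of 1 \<xi>] by (simp add: S_def)
    finally show ?thesis .
  qed
  moreover have "{x. (\<xi>, x) \<in> tower n} \<subseteq> (\<Union>c\<in>A. cball c (\<Gamma> n))"
  proof
    fix x assume "x \<in> {x. (\<xi>, x) \<in> tower n}"
    then obtain l a where "l < len n" "a < 2" "sees n l a \<xi>" "dist x (pt n l) \<le> \<Gamma> n"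
      by (auto simp: tower_iff)
    moreover from this have "a = 0 \<or> a = 1" by linarith
    ultimately have "pt n l \<in> A" by (auto simp: A_def S_def)
    with \<open>dist x (pt n l) \<le> \<Gamma> n\<close> show "x \<in> (\<Union>c\<in>A. cball c (\<Gamma> n))"
      by (auto simp: dist_commute)
  qed
  ultimately show ?thesis by (intro exI[of _ A]) (simp add: A_def)
qed

text \<open>Both sequences agree on the repeated block of length \<open>X\<close>. Here
  \<open>2 * len n \<le> X\<close> because there are at least two copies, and
  \<open>2 * e \<le> X\<close> because the tail is no longer than the block, so the two periods fit
  into the window of \<open>periodic_agree\<close>.\<close>

lemma same_sequence_if_short_period:
  assumes "short_period (Suc n)" and "ratio (Suc n) \<le> 1"
  shows "generated_by (w (Suc n)) = generated_by (w n)"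
proof -
  obtain e where e: "0 < e" "4 * e \<le> len (Suc n)" "has_period e (generated_by (w (Suc n)))"
    using assms(1) unfolding short_period_def by blast
  define X where "X = m (Suc n) * len n"
  have X: "2 * len n \<le> X" using m_Suc[of n] by (simp add: X_def)
  then have "0 < X" using len_pos[of n] by linarith
  then have "real (length (\<alpha> (Suc n))) \<le> real X" using assms(2) by (simp add: tail_ratio_def X_def)
  then have "2 * e \<le> X" using e(2) unfolding len_Suc[of n] X_def[symmetric] by linarith
  with X have "len n + e \<le> X" by linarith
  then have "generated_by (w n) = generated_by (w (Suc n))"
  proof (rule periodic_agree[OF generated_by_period len_pos e(3,1)])
    fix i assume i: "i < X"
    then have "i < len (Suc n)" unfolding len_Suc[of n] X_def by linarith
    then show "generated_by (w n) (int i) = generated_by (w (Suc n)) (int i)"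
      using w_Suc_nth[of i n] i by (simp add: generated_by_nat w_nonempty X_def)
  qed
  then show ?thesis by simp
qed

text \<open>Equal sequences make the words commute, hence also their maps. The map of
  \<open>w (Suc n)\<close> thus sends \<open>q n\<close> to a fixed point of the map of
  \<open>w n\<close> in \<open>J n\<close>, that is, to \<open>q n\<close> itself; uniqueness for
  \<open>w (Suc n)\<close> identifies \<open>q n\<close> with \<open>q (Suc n)\<close>.\<close>

lemma same_point_if_same_sequence:
  assumes small: "arc_length (J n) < pi" and same: "generated_by (w (Suc n)) = generated_by (w n)"
  shows "q (Suc n) = q n"
proof -
  have nth: "w i ! j = generated_by (w i) (int j)" if "j < len i" for i j
    using that by (simp add: generated_by_nat w_nonempty)
  have shift: "generated_by (w i) (int (j - len i)) = generated_by (w i) (int j)" if "len i \<le> j" for i j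
    using that generated_by_period[of "w i", unfolded has_period_def, rule_format, of "int (j - len i)"]
    by (simp add: of_nat_diff)
  \<comment> \<open>Both concatenations are prefixes of the common periodic sequence, because each
    word is one of its periods.\<close>
  have "w n @ w (Suc n) = w (Suc n) @ w n"
  proof (rule nth_equalityI)
    fix j assume "j < length (w n @ w (Suc n))"
    then have j: "j < len n + len (Suc n)" by simp
    have "(w n @ w (Suc n)) ! j = generated_by (w n) (int j)"
      using nth[of j n] nth[of "j - len n" "Suc n"] shift[of n j] same j by (simp add: nth_append)
    moreover have "(w (Suc n) @ w n) ! j = generated_by (w n) (int j)"
      using nth[of j "Suc n"] nth[of "j - len (Suc n)" n] shift[of "Suc n" j] same j by (simp add: nth_append)
    ultimately show "(w n @ w (Suc n)) ! j = (w (Suc n) @ w n) ! j" by simp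
  qed simp
  then have comm: "word_map f (w (Suc n)) (word_map f (w n) x) = word_map f (w n) (word_map f (w (Suc n)) x)" for x
    by (metis comp_apply fold_append)
  let ?x = "word_map f (w (Suc n)) (q n)"
  have "?x \<in> J n" using J_invariant q_mem by blast
  moreover have "word_map f (w n) ?x = ?x" using comm[of "q n"] q_fixed[of n] by simp
  ultimately have "?x = q n"
    by (intro unique_fixpoint[OF small w_letters contracting _ q_mem _ q_fixed])
  then show ?thesis
    by (intro unique_fixpoint[OF small w_letters contracting_Suc q_Suc_mem q_mem q_fixed])
qed

section \<open>The two cases of the argument and the conclusion\<close>

text \<open>All later periodic orbits start at the same point, so each of them lies in the closed
  set where the fiber coordinate is one of finitely many \<open>pt n0 l\<close>, and the limit gives
  this set full mass.\<close>

lemma AE_finite_fibers_periodic: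
  assumes \<mu>: "prob_space \<mu>" "sets \<mu> = sets (skew_borel k)" and lim: "weak_star_limit k orbit \<mu>"
    and same: "\<And>n. n0 \<le> n \<Longrightarrow> generated_by (w n) = generated_by (w n0)" "\<And>n. n0 \<le> n \<Longrightarrow> q n = q n0"
  shows "AE z in \<mu>. snd z \<in> pt n0 ` {..<len n0}"
proof -
  define \<psi> where "\<psi> z = (\<Prod>l<len n0. dist (snd z) (pt n0 l))" for z :: "(int \<Rightarrow> nat) \<times> complex"
  have cont: "continuous_on UNIV \<psi>" unfolding \<psi>_def by (intro continuous_intros continuous_on_prod)
  define D where "D = {z. \<psi> z = 0}"
  have D_iff: "z \<in> D \<longleftrightarrow> snd z \<in> pt n0 ` {..<len n0}" for z
    by (auto simp: D_def \<psi>_def)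
  let ?z = "(generated_by (w n0), q n0)"
  have per: "(skew_product f ^^ len n0) ?z = ?z"
    using pattern unfolding repetitive_pattern_def by blast
  have inD: "(skew_product f ^^ j) ?z \<in> D" for j
  proof -
    have "j mod len n0 < len n0" using len_pos by simp
    then show ?thesis using orbit_point[of "j mod len n0" n0]
      unfolding funpow_mod_period[OF per, of j] D_iff by auto
  qed
  have sets_D: "D \<inter> skew_space k \<in> sets (skew_borel k)" unfolding D_def by (rule zero_set_sets[OF cont])
  have "1 \<le> measure (orbit n) (D \<inter> skew_space k)" if n: "n0 \<le> n" for n
  proof -
    have "(skew_product f ^^ j) (generated_by (w n), q n) \<in> D \<inter> skew_space k" if "j < len n" for j
      using inD[of j] orbit_in_skew_space[of j n] same[OF n] that by simp
    then have "{j. j < len n \<and> (skew_product f ^^ j) (generated_by (w n), q n) \<in> D \<inter> skew_space k} = {..<len n}"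
      by auto
    then show ?thesis unfolding orbit_def
      using measure_orbit_measure[OF orbit_in_skew_space[OF less_imp_le] sets_D] len_pos[of n]
      by simp
  qed
  then have "1 \<le> measure \<mu> (D \<inter> skew_space k)"
    by (intro weak_star_limit_zero_set[OF lim \<mu>(1) prob_space_orbit \<mu>(2) sets_orbit cont _ D_def])
       (auto simp: \<psi>_def prod_nonneg eventually_sequentially)
  then have "AE z in \<mu>. z \<in> D \<inter> skew_space k"
    using sets_D \<mu> prob_space.prob_le_1[OF \<mu>(1), of "D \<inter> skew_space k"]
    by (intro prob_space.AE_prob_1[OF \<mu>(1)]) auto
  then show ?thesis by (auto simp: D_iff)
qed

text \<open>Borel-Cantelli along levels without short period: almost every point lies in all but
  finitely many of the selected towers.\<close>

lemma AE_countable_fibers: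
  assumes \<mu>: "prob_space \<mu>" "sets \<mu> = sets (skew_borel k)" and lim: "weak_star_limit k orbit \<mu>"
    and inf: "\<And>N. \<exists>n\<ge>N. \<not> short_period n"
  shows "\<exists>C. (\<forall>\<xi>. countable (C \<xi>)) \<and> (AE z in \<mu>. snd z \<in> C (fst z))"
proof -
  interpret prob_space \<mu> by (rule \<mu>)
  have "\<forall>\<^sub>F n in sequentially. arc_length (J n) < pi"
    using J_lim pi_gt_zero by (rule order_tendstoD)
  then obtain n0 where n0: "\<And>n. n0 \<le> n \<Longrightarrow> arc_length (J n) < pi" by (auto simp: eventually_sequentially)
  have lower: "1 - \<Lambda> (Suc n) \<le> measure \<mu> (tower (Suc n) \<inter> skew_space k)" if "n0 \<le> n" for n
  proof (rule weak_star_limit_zero_set[OF lim \<mu>(1) prob_space_orbit \<mu>(2) sets_orbit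
        continuous_tower_defect tower_defect_nonneg tower_def])
    have "1 - \<Lambda> (Suc n) \<le> measure (orbit N) (tower (Suc n) \<inter> skew_space k)" if "Suc (Suc n) \<le> N" for N
      using measure_orbit_tower[OF n0[OF \<open>n0 \<le> n\<close>], of "N - Suc (Suc n)"]
      unfolding le_add_diff_inverse[OF that] .
    then show "\<forall>\<^sub>F N in sequentially. 1 - \<Lambda> (Suc n) \<le> measure (orbit N) (tower (Suc n) \<inter> skew_space k)"
      by (auto simp: eventually_sequentially)
  qed
  \<comment> \<open>The selected levels lose less than \<open>(1 / 2) ^ i\<close>, a summable bound.
    They are written as successors because the lower bound on the mass of a tower is stated for
    those.\<close>
  have "\<exists>n. n0 \<le> n \<and> i \<le> n \<and> \<not> short_period (Suc n) \<and> \<Lambda> (Suc n) < (1 / 2) ^ i" for i :: nat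
  proof -
    have "\<forall>\<^sub>F n in sequentially. \<Lambda> n < (1 / 2) ^ i" using \<Lambda>_lim by (rule order_tendstoD) simp
    then obtain N where N: "\<And>n. N \<le> n \<Longrightarrow> \<Lambda> n < (1 / 2) ^ i" by (auto simp: eventually_sequentially)
    obtain n where n: "Suc (max N (max n0 i)) \<le> n" "\<not> short_period n" using inf by blast
    then have "Suc (n - 1) = n" "N \<le> n" "n0 \<le> n - 1" "i \<le> n - 1" by linarith+
    then show ?thesis using N[of n] n(2) by (intro exI[of _ "n - 1"]) simp
  qed
  then obtain r where r: "\<And>i. n0 \<le> r i" "\<And>i. i \<le> r i" "\<And>i. \<not> short_period (Suc (r i))"
      "\<And>i. \<Lambda> (Suc (r i)) < (1 / 2) ^ i" by metis
  define B where "B i = space \<mu> - (tower (Suc (r i)) \<inter> skew_space k)" for i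
  have tower_sets: "tower (Suc (r i)) \<inter> skew_space k \<in> sets \<mu>" for i
    unfolding tower_def using zero_set_sets[OF continuous_tower_defect] \<mu>(2) by blast
  then have B: "B i \<in> sets \<mu>" for i by (auto simp: B_def)
  have B_le: "measure \<mu> (B i) \<le> (1 / 2) ^ i" for i
    using lower[OF r(1), of i] r(4)[of i] prob_compl[OF tower_sets[of i]] by (simp add: B_def)
  have "summable (\<lambda>i. measure \<mu> (B i))"
  proof (rule summable_comparison_test')
    show "summable (\<lambda>i. (1 / 2 :: real) ^ i)" by (rule summable_geometric) simp
    show "norm (measure \<mu> (B i)) \<le> (1 / 2) ^ i" if "0 \<le> i" for i using B_le[of i] by simp
  qed
  then have "AE z in \<mu>. \<forall>\<^sub>F i in sequentially. z \<in> space \<mu> - B i"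
    using B by (intro borel_cantelli_AE1) (auto simp: emeasure_finite less_top[symmetric])
  \<comment> \<open>This is the union over \<open>I\<close> of the sets of points lying in every
    selected tower from \<open>I\<close> on. Each such set is covered by eight balls at every scale,
    hence finite.\<close>
  define C where "C \<xi> = {x. \<forall>\<^sub>F i in sequentially. (\<xi>, x) \<in> tower (Suc (r i))}" for \<xi>
  have "countable (C \<xi>)" for \<xi>
  proof -
    have "finite {x. \<forall>i\<ge>I. (\<xi>, x) \<in> tower (Suc (r i))}" for I
    proof (rule finite_if_covered_by_balls)
      fix i
      obtain A where "finite A" "card A \<le> 8"
          "{x. (\<xi>, x) \<in> tower (Suc (r (i + I)))} \<subseteq> (\<Union>c\<in>A. cball c (\<Gamma> (Suc (r (i + I)))))"
        using tower_fiber_cover[OF r(3)] by blast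
      moreover have "{x. \<forall>i\<ge>I. (\<xi>, x) \<in> tower (Suc (r i))} \<subseteq> {x. (\<xi>, x) \<in> tower (Suc (r (i + I)))}"
        by auto
      ultimately show "\<exists>A. finite A \<and> card A \<le> 8 \<and>
          {x. \<forall>i\<ge>I. (\<xi>, x) \<in> tower (Suc (r i))} \<subseteq> (\<Union>c\<in>A. cball c (\<Gamma> (Suc (r (i + I)))))"
        by (meson order_trans)
    next
      \<comment> \<open>The requirement \<open>i \<le> r i\<close> sends the levels to infinity, so
        the radii tend to zero.\<close>
      have "filterlim (\<lambda>i. Suc (r (i + I))) at_top sequentially"
        by (rule filterlim_at_top_mono[OF filterlim_ident])
           (intro always_eventually allI le_trans[OF _ le_SucI[OF r(2)]], simp)
      then show "(\<lambda>i. \<Gamma> (Suc (r (i + I)))) \<longlonglongrightarrow> 0" by (rule filterlim_compose[OF \<Gamma>_lim])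
    qed
    then have "countable (\<Union>I. {x. \<forall>i\<ge>I. (\<xi>, x) \<in> tower (Suc (r i))})"
      by (intro countable_UN) (auto intro: countable_finite)
    moreover have "C \<xi> = (\<Union>I. {x. \<forall>i\<ge>I. (\<xi>, x) \<in> tower (Suc (r i))})"
      by (auto simp: C_def eventually_sequentially)
    ultimately show ?thesis by simp
  qed
  moreover have "AE z in \<mu>. snd z \<in> C (fst z)"
    using \<open>AE z in \<mu>. \<forall>\<^sub>F i in sequentially. z \<in> space \<mu> - B i\<close>
  proof eventually_elim
    case (elim z)
    then have "\<forall>\<^sub>F i in sequentially. z \<in> tower (Suc (r i))"
      by eventually_elim (auto simp: B_def)
    then show ?case by (simp add: C_def)
  qed
  ultimately show ?thesis by blast
qed

lemma atomic_disintegration_limit: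
  assumes \<mu>: "prob_space \<mu>" "sets \<mu> = sets (skew_borel k)" and lim: "weak_star_limit k orbit \<mu>"
  shows "atomic_disintegration k \<mu>"
proof (cases "\<forall>N. \<exists>n\<ge>N. \<not> short_period n")
  case True
  then obtain C where "\<And>\<xi>. countable (C \<xi>)" "AE z in \<mu>. snd z \<in> C (fst z)"
    using AE_countable_fibers[OF \<mu> lim] by blast
  then show ?thesis by (rule atomic_disintegrationI[OF \<mu>])
next
  case False
  then obtain N1 where N1: "\<And>n. N1 \<le> n \<Longrightarrow> short_period n" by blast
  have "\<forall>\<^sub>F n in sequentially. arc_length (J n) < pi"
    using J_lim pi_gt_zero by (rule order_tendstoD)
  moreover have "\<forall>\<^sub>F n in sequentially. ratio (Suc n) < 1"
    using summable_LIMSEQ_zero[OF summable_ratio] by (rule order_tendstoD) simp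
  ultimately have "\<forall>\<^sub>F n in sequentially. arc_length (J n) < pi \<and> ratio (Suc n) < 1"
    by (rule eventually_conj)
  then obtain N2 where N2: "\<And>n. N2 \<le> n \<Longrightarrow> arc_length (J n) < pi" "\<And>n. N2 \<le> n \<Longrightarrow> ratio (Suc n) < 1"
    by (auto simp: eventually_sequentially)
  \<comment> \<open>Beyond \<open>n0\<close> all periods are short, arcs are below \<open>pi\<close>
    and tails are shorter than the repeated block, so sequences and points no longer change.\<close>
  define n0 where "n0 = max N1 N2"
  have step: "generated_by (w (Suc n)) = generated_by (w n)" "q (Suc n) = q n" if "n0 \<le> n" for n
  proof -
    show *: "generated_by (w (Suc n)) = generated_by (w n)"
      using that N1[of "Suc n"] N2(2)[of n] by (intro same_sequence_if_short_period) (auto simp: n0_def)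
    show "q (Suc n) = q n"
      using that N2(1)[of n] by (intro same_point_if_same_sequence *) (auto simp: n0_def)
  qed
  have "generated_by (w n) = generated_by (w n0)" "q n = q n0" if "n0 \<le> n" for n
    using that by (induction n rule: dec_induct) (auto simp: step)
  then have "AE z in \<mu>. snd z \<in> pt n0 ` {..<len n0}"
    by (rule AE_finite_fibers_periodic[OF \<mu> lim])
  then show ?thesis
    by (intro atomic_disintegrationI[OF \<mu>, of "\<lambda>_. pt n0 ` {..<len n0}"]) auto
qed

end

theorem corollary2p7:
  fixes k :: nat and f :: "nat \<Rightarrow> complex \<Rightarrow> complex"
    and \<mu> :: "((int \<Rightarrow> nat) \<times> complex) measure"
  assumes "k \<ge> 1"
    and "\<And>j. j \<in> {1..k} \<Longrightarrow> circle_C1_diffeo (f j)"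
    and "GIKN_measure k f \<mu>"
  shows "atomic_disintegration k \<mu>"
proof -
  obtain w q J m \<alpha> where sets: "sets \<mu> = sets (skew_borel k)" and erg: "ergodic_measure (skew_product f) \<mu>"
    and pat: "repetitive_pattern k f w q J m \<alpha>" and cond: "GIKN_conditions k f w q J m \<alpha>"
    and lim: "weak_star_limit k (\<lambda>n. orbit_measure k f (length (w n)) (generated_by (w n), q n)) \<mu>"
    using assms(3) unfolding GIKN_measure_def by blast
  define L where "L = (MAX j\<in>{1..k}. SUP x\<in>circle. abs_deriv (f j) x)"
  obtain \<gamma> where \<gamma>: "summable \<gamma>" "\<And>n. L ^ length (w n) * arc_length (J n) < \<gamma> n"
    using cond unfolding GIKN_conditions_def L_def by blast
  interpret gikn_pattern k f w q J m \<alpha> L \<gamma>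
    using assms(1,2) pat cond L_def \<gamma> by unfold_locales
  have "weak_star_limit k orbit \<mu>" using lim unfolding orbit_def .
  then show ?thesis
    using erg sets unfolding ergodic_measure_def by (intro atomic_disintegration_limit) auto
qed

end
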